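(* Let $q = 2^n$ with $n > 1$. If $q+1$ is prime or $q^2-q+1$ is prime, then the projective special unitary group $PSU_3(q)$ has a minimal logarithmic signature.
   Context: All groups are finite. For a finite group $G$, a logarithmic signature of $G$ is an ordered tuple $[A_1,\ldots,A_s]$ of subsets $A_i \subseteq G$ such that every element $g \in G$ can be written uniquely as a product $g = a_1a_2\cdots a_s$ with $a_i \in A_i$ for each $i$. Its length is $\sum_{i=1}^s |A_i|$. If $|G| = p_1^{\beta_1}\cdots p_k^{\beta_k}$ with $p_1,\ldots,p_k$ distinct primes and $\beta_j \ge 1$, every logarithmic signature has length at least $\sum_{j=1}^k \beta_j p_j$, and a logarithmic signature is called minimal (an MLS) if its length equals $\sum_{j=1}^k \beta_j p_j$. $PSU_3(q)$ is the projective special unitary group $SU_3(q)/Z(SU_3(q))$, where $SU_3(q)$ is the special unitary group of dimension $3$ over $GF(q^2)$. *)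

theory Defs
  imports "HOL-Analysis.Determinants" "HOL-Algebra.Coset"
    "HOL-Computational_Algebra.Primes"
begin

definition list_prod :: "('a, 'b) monoid_scheme \<Rightarrow> 'a list \<Rightarrow> 'a" where
  "list_prod G xs = foldr (\<lambda>x y. x \<otimes>\<^bsub>G\<^esub> y) xs \<one>\<^bsub>G\<^esub>"

definition logarithmic_signature :: "('a, 'b) monoid_scheme \<Rightarrow> 'a set list \<Rightarrow> bool" where
  "logarithmic_signature G As \<longleftrightarrow>
     (\<forall>A \<in> set As. A \<subseteq> carrier G) \<and>
     (\<forall>g \<in> carrier G. \<exists>!xs. length xs = length As \<and> (\<forall>i < length As. xs ! i \<in> As ! i)
                                 \<and> list_prod G xs = g)"

definition ls_length :: "'a set list \<Rightarrow> nat" where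
  "ls_length As = sum_list (map card As)"

definition mls_bound :: "nat \<Rightarrow> nat" where
  "mls_bound N = (\<Sum>p \<in> prime_factors N. multiplicity p N * p)"

definition minimal_logarithmic_signature :: "('a, 'b) monoid_scheme \<Rightarrow> 'a set list \<Rightarrow> bool" where
  "minimal_logarithmic_signature G As \<longleftrightarrow>
     logarithmic_signature G As \<and> ls_length As = mls_bound (order G)"

definition has_MLS :: "('a, 'b) monoid_scheme \<Rightarrow> bool" where
  "has_MLS G \<longleftrightarrow> (\<exists>As. minimal_logarithmic_signature G As)"

definition group_center :: "('a, 'b) monoid_scheme \<Rightarrow> 'a set" where
  "group_center G = {z \<in> carrier G. \<forall>g \<in> carrier G. z \<otimes>\<^bsub>G\<^esub> g = g \<otimes>\<^bsub>G\<^esub> z}"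

(* Hermitian conjugate w.r.t. the involution x \<mapsto> x^q of GF(q^2) *)
definition conj_transpose :: "nat \<Rightarrow> 'a::field^3^3 \<Rightarrow> 'a^3^3" where
  "conj_transpose q A = (\<chi> i j. (A $ j $ i) ^ q)"

(* SU_3(q) over the field 'a = GF(q^2), w.r.t. the standard Hermitian form *)
definition SU3 :: "nat \<Rightarrow> ('a::field^3^3) monoid" where
  "SU3 q = \<lparr> carrier = {A. det A = 1 \<and> A ** conj_transpose q A = mat 1},
             mult = (\<lambda>A B. A ** B), one = mat 1 \<rparr>"

definition PSU3 :: "nat \<Rightarrow> ('a::field^3^3) set monoid" where
  "PSU3 q = SU3 q Mod group_center (SU3 q)"

end

theory Submission
  imports "HOL-Computational_Algebra.Polynomial" Defs "HOL-Algebra.Sylow" "HOL-Algebra.Multiplicative_Group"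
begin

text \<open>
  Both hypotheses force \<open>gcd 3 (q + 1) = 1\<close>, so the centre of \<open>SU\<^sub>3(q)\<close> is trivial and it suffices to
  treat \<open>G = SU\<^sub>3(q)\<close>. Let \<open>B\<close> be the stabiliser of an isotropic line, of index \<open>q\<^sup>3 + 1 = (q + 1) (q\<^sup>2 - q + 1)\<close>.
  If \<open>H\<close> is a subgroup meeting every conjugate of \<open>B\<close> trivially, all double cosets \<open>H g B\<close> have
  the full size \<open>|H| |B|\<close>, hence \<open>G = H X B\<close> with unique factorisation for any set \<open>X\<close> of
  representatives. If \<open>|X|\<close> is prime, then \<open>X\<close> itself serves as one block.

  If \<open>q + 1\<close> is prime, take for \<open>H\<close> a Singer-type subgroup of order \<open>q\<^sup>2 - q + 1\<close>, which is coprime to \<open>|B|\<close>. If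
  \<open>q\<^sup>2 - q + 1\<close> is prime, take \<open>H = {diag(a, 1, a\<^sup>-\<^sup>1) | a\<^sup>q\<^sup>+\<^sup>1 = 1}\<close>: as \<open>q + 1\<close> is odd, a nontrivial element
  has three distinct eigenvalues and fixes no isotropic line.

  The group \<open>B\<close> is the product of a \<open>2\<close>-group of order \<open>q\<^sup>3\<close> and an abelian group of order \<open>q\<^sup>2 - 1\<close>, and
  \<open>H\<close> is abelian. Groups of prime power order and abelian groups have minimal logarithmic
  signatures by Sylow's theorem.
\<close>

section \<open>Minimal logarithmic signatures of subsets\<close>

text \<open>\<open>mls_bound\<close> is additive on products of positive numbers, so minimality
  survives whenever exact factorisations are concatenated. For this reason \<open>mls_set\<close>
  speaks of arbitrary subsets: the pieces of a factorisation are treated separately, whether or not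
  they are subgroups. The obstacle is the set of double coset representatives. It has no structure
  along which it could be refined, so it enters as a single block, and a block of prime size meets
  the bound. As the index of the Borel subgroup is \<open>(q + 1) * (q^2 - q + 1)\<close>, one
  factor has to be absorbed by \<open>H\<close> and the other has to be the prime. All group orders
  come from one fact: \<open>SU\<close> acts simply transitively on pairs of isotropic vectors with
  product 1, so it is enough to count vectors. The Singer-type subgroup is not given by explicit
  matrices. Cauchy's theorem supplies an element of suitable prime order, and the subgroup is found
  inside the abelian unit group of its centraliser. The condition on 3 arises because
  \<open>q = -1\<close> modulo 3 makes both \<open>q + 1\<close> and \<open>q^2 - q + 1\<close>
  multiples of 3.\<close>

definition mls_set :: "('a, 'b) monoid_scheme \<Rightarrow> 'a set \<Rightarrow> bool" where
  "mls_set G S \<longleftrightarrow> finite S \<and> S \<noteq> {} \<and>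
     (\<exists>As. (\<forall>A \<in> set As. A \<subseteq> carrier G) \<and>
        bij_betw (list_prod G) {xs. list_all2 (\<in>) xs As} S \<and> ls_length As = mls_bound (card S))"

lemma mls_bound_mult:
  assumes "a > 0" "b > 0"
  shows "mls_bound (a * b) = mls_bound a + mls_bound b"
proof -
  let ?P = "prime_factors (a * b)"
  \<comment> \<open>Primes of \<open>a * b\<close> missing from a factor have multiplicity 0 in it,
    so all three bounds become sums over the same set of primes.\<close>
  have *: "mls_bound N = (\<Sum>p\<in>?P. multiplicity p N * p)" if "N > 0" "N dvd a * b" for N
    unfolding mls_bound_def
  proof (rule sum.mono_neutral_left)
    show "prime_factors N \<subseteq> ?P"
      using that assms by (intro dvd_prime_factors) auto
    show "\<forall>p\<in>?P - prime_factors N. multiplicity p N * p = 0"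
      using that by (auto simp: in_prime_factors_iff not_dvd_imp_multiplicity_0)
  qed auto
  have "mls_bound (a * b) = (\<Sum>p\<in>?P. multiplicity p a * p + multiplicity p b * p)"
    unfolding mls_bound_def using assms
    by (intro sum.cong refl)
       (auto simp: prime_elem_multiplicity_mult_distrib in_prime_factors_iff add_mult_distrib)
  then show ?thesis
    using assms by (simp add: * sum.distrib)
qed

lemma mls_bound_prime:
  assumes "prime p"
  shows "mls_bound p = p"
  using assms by (simp add: mls_bound_def prime_prime_factors)

lemma list_prod_Nil [simp]: "list_prod G [] = \<one>\<^bsub>G\<^esub>"
  and list_prod_Cons [simp]: "list_prod G (x # xs) = x \<otimes>\<^bsub>G\<^esub> list_prod G xs"
  by (simp_all add: list_prod_def)

lemma list_all2_mem_carrier: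
  assumes "list_all2 (\<in>) xs As" "\<forall>A \<in> set As. A \<subseteq> C"
  shows "set xs \<subseteq> C"
  using assms by (induction rule: list_all2_induct) auto

lemma (in monoid) list_prod_closed:
  "set xs \<subseteq> carrier G \<Longrightarrow> list_prod G xs \<in> carrier G"
  by (induction xs) auto

lemma (in monoid) list_prod_append:
  "set xs \<subseteq> carrier G \<Longrightarrow> set ys \<subseteq> carrier G \<Longrightarrow>
    list_prod G (xs @ ys) = list_prod G xs \<otimes> list_prod G ys"
  by (induction xs) (auto simp: list_prod_closed m_assoc)

lemma (in monoid) mls_set_subset_carrier:
  assumes "mls_set G S"
  shows "S \<subseteq> carrier G"
proof -
  obtain As where "\<forall>A \<in> set As. A \<subseteq> carrier G"
      and bij: "bij_betw (list_prod G) {xs. list_all2 (\<in>) xs As} S"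
    using assms by (auto simp: mls_set_def)
  then have "list_prod G xs \<in> carrier G" if "list_all2 (\<in>) xs As" for xs
    using that by (meson list_all2_mem_carrier list_prod_closed)
  then show ?thesis
    using bij by (auto simp: bij_betw_def)
qed

text \<open>The empty tuple of blocks has the empty product as its only product, and
  \<open>mls_bound 1 = 0\<close>.\<close>

lemma mls_set_one: "mls_set G {\<one>\<^bsub>G\<^esub>}"
  unfolding mls_set_def
  by (auto intro!: exI[of _ "[]"] simp: ls_length_def mls_bound_def bij_betw_def)

lemma (in monoid) mls_set_prime:
  assumes "S \<subseteq> carrier G" "prime (card S)"
  shows "mls_set G S"
proof -
  have S: "finite S" "S \<noteq> {}"
    using assms(2) by (auto intro: card_ge_0_finite simp: prime_gt_0_nat)
  have "{xs. list_all2 (\<in>) xs [S]} = (\<lambda>x. [x]) ` S"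
    by (auto simp: list_all2_Cons2)
  moreover have "bij_betw (list_prod G) ((\<lambda>x. [x]) ` S) S"
  proof (rule bij_betw_imageI)
    show "inj_on (list_prod G) ((\<lambda>x. [x]) ` S)"
      using assms(1) by (auto simp: inj_on_def subset_iff)
    show "list_prod G ` (\<lambda>x. [x]) ` S = S"
      using assms(1) by (auto simp: image_image subset_iff image_iff)
  qed
  ultimately show ?thesis
    unfolding mls_set_def using S assms
    by (intro conjI exI[of _ "[S]"]) (auto simp: ls_length_def mls_bound_prime)
qed

text \<open>Concatenating the two tuples works because the product map on \<open>S\<close> and
  \<open>T\<close> is injective; the lengths add up just as \<open>mls_bound\<close> does.\<close>

lemma (in monoid) mls_set_mult:
  assumes "mls_set G S" "mls_set G T" "inj_on (\<lambda>(s, t). s \<otimes> t) (S \<times> T)"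
  shows "mls_set G (S <#> T)" and "card (S <#> T) = card S * card T"
proof -
  obtain As where As: "\<forall>A \<in> set As. A \<subseteq> carrier G"
      "bij_betw (list_prod G) {xs. list_all2 (\<in>) xs As} S" "ls_length As = mls_bound (card S)"
    using assms(1) by (auto simp: mls_set_def)
  obtain Bs where Bs: "\<forall>A \<in> set Bs. A \<subseteq> carrier G"
      "bij_betw (list_prod G) {xs. list_all2 (\<in>) xs Bs} T" "ls_length Bs = mls_bound (card T)"
    using assms(2) by (auto simp: mls_set_def)
  have fin: "finite S" "S \<noteq> {}" "finite T" "T \<noteq> {}"
    using assms by (auto simp: mls_set_def)
  have ST: "S <#> T = (\<lambda>(s, t). s \<otimes> t) ` (S \<times> T)"
    by (auto simp: set_mult_def)
  show card: "card (S <#> T) = card S * card T"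
    unfolding ST using assms(3) by (simp add: card_image card_cartesian_product)
  have split: "\<exists>us vs. xs = us @ vs \<and> list_all2 (\<in>) us As \<and> list_all2 (\<in>) vs Bs \<and>
      list_prod G us \<in> S \<and> list_prod G vs \<in> T \<and>
      list_prod G xs = list_prod G us \<otimes> list_prod G vs"
    if "list_all2 (\<in>) xs (As @ Bs)" for xs
  proof -
    obtain us vs where uv: "xs = us @ vs" "list_all2 (\<in>) us As" "list_all2 (\<in>) vs Bs"
      using \<open>list_all2 (\<in>) xs (As @ Bs)\<close> by (auto simp: list_all2_append2)
    moreover have "list_prod G us \<in> S" "list_prod G vs \<in> T"
      using uv As(2) Bs(2) by (auto simp: bij_betw_def)
    moreover have "set us \<subseteq> carrier G" "set vs \<subseteq> carrier G"
      using uv As(1) Bs(1) by (blast dest: list_all2_mem_carrier)+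
    ultimately show ?thesis
      by (metis list_prod_append)
  qed
  have "bij_betw (list_prod G) {xs. list_all2 (\<in>) xs (As @ Bs)} (S <#> T)"
  proof (rule bij_betw_imageI)
    show "inj_on (list_prod G) {xs. list_all2 (\<in>) xs (As @ Bs)}"
    proof (rule inj_onI, simp only: mem_Collect_eq)
      fix xs ys
      assume xs: "list_all2 (\<in>) xs (As @ Bs)" and ys: "list_all2 (\<in>) ys (As @ Bs)"
        and eq: "list_prod G xs = list_prod G ys"
      obtain us vs where uv: "xs = us @ vs" "list_all2 (\<in>) us As" "list_all2 (\<in>) vs Bs"
          "list_prod G us \<in> S" "list_prod G vs \<in> T"
          "list_prod G xs = list_prod G us \<otimes> list_prod G vs"
        using split[OF xs] by blast
      obtain us' vs' where uv': "ys = us' @ vs'" "list_all2 (\<in>) us' As" "list_all2 (\<in>) vs' Bs"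
          "list_prod G us' \<in> S" "list_prod G vs' \<in> T"
          "list_prod G ys = list_prod G us' \<otimes> list_prod G vs'"
        using split[OF ys] by blast
      have "(\<lambda>(s, t). s \<otimes> t) (list_prod G us, list_prod G vs) =
            (\<lambda>(s, t). s \<otimes> t) (list_prod G us', list_prod G vs')"
        using uv uv' eq by simp
      then have "list_prod G us = list_prod G us'" "list_prod G vs = list_prod G vs'"
        using inj_onD[OF assms(3)] uv(4,5) uv'(4,5) by blast+
      then have "us = us'" "vs = vs'"
        using uv uv' As(2) Bs(2) by (auto simp: bij_betw_def inj_on_def)
      then show "xs = ys"
        using uv uv' by simp
    qed
    show "list_prod G ` {xs. list_all2 (\<in>) xs (As @ Bs)} = S <#> T"
    proof (intro equalityI subsetI)
      fix x assume "x \<in> list_prod G ` {xs. list_all2 (\<in>) xs (As @ Bs)}"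
      then show "x \<in> S <#> T"
        using split by (fastforce simp: ST)
    next
      fix x assume "x \<in> S <#> T"
      then obtain s t where st: "s \<in> S" "t \<in> T" "x = s \<otimes> t"
        by (auto simp: ST)
      obtain us vs where uv: "list_all2 (\<in>) us As" "list_all2 (\<in>) vs Bs"
          "list_prod G us = s" "list_prod G vs = t"
        using st As(2) Bs(2) by (auto simp: bij_betw_def)
      then have "set us \<subseteq> carrier G" "set vs \<subseteq> carrier G"
        using As(1) Bs(1) by (blast dest: list_all2_mem_carrier)+
      then have "list_prod G (us @ vs) = x"
        by (simp add: list_prod_append uv st)
      then show "x \<in> list_prod G ` {xs. list_all2 (\<in>) xs (As @ Bs)}"
        using uv by (auto intro!: image_eqI[of _ _ "us @ vs"] list_all2_appendI)
    qed
  qed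
  moreover have "ls_length (As @ Bs) = mls_bound (card (S <#> T))"
    using As(3) Bs(3) fin by (simp add: card mls_bound_mult card_gt_0_iff ls_length_def)
  moreover have "finite (S <#> T)" "S <#> T \<noteq> {}"
    using fin by (auto simp: ST)
  ultimately show "mls_set G (S <#> T)"
    unfolding mls_set_def using As(1) Bs(1) by (intro conjI exI[of _ "As @ Bs"]) auto
qed

lemma mls_set_imp_has_MLS:
  assumes "mls_set G (carrier G)"
  shows "has_MLS G"
proof -
  obtain As where As: "\<forall>A \<in> set As. A \<subseteq> carrier G"
      "bij_betw (list_prod G) {xs. list_all2 (\<in>) xs As} (carrier G)"
      "ls_length As = mls_bound (card (carrier G))"
    using assms by (auto simp: mls_set_def)
  have "\<exists>!xs. list_all2 (\<in>) xs As \<and> list_prod G xs = g" if "g \<in> carrier G" for g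
  proof -
    have "g \<in> list_prod G ` {xs. list_all2 (\<in>) xs As}"
      using As(2) \<open>g \<in> carrier G\<close> by (simp add: bij_betw_def)
    then obtain xs where "list_all2 (\<in>) xs As" "list_prod G xs = g"
      by blast
    then show ?thesis
      using As(2) by (auto simp: bij_betw_def inj_on_def)
  qed
  then have "logarithmic_signature G As"
    using As(1) by (simp add: logarithmic_signature_def list_all2_conv_all_nth conj_assoc)
       (metis (no_types, lifting))
  then show ?thesis
    using As(3) by (auto simp: has_MLS_def minimal_logarithmic_signature_def order_def)
qed

text \<open>\<open>list_prod\<close> uses only the multiplication and the unit, which do not change
  when the carrier is restricted.\<close>

lemma mls_set_subgroup:
  assumes "mls_set (G\<lparr>carrier := K\<rparr>) S" "K \<subseteq> carrier G"
  shows "mls_set G S"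
proof -
  have "list_prod (G\<lparr>carrier := K\<rparr>) = list_prod G"
    by (auto simp: list_prod_def)
  then show ?thesis
    using assms unfolding mls_set_def by auto (metis (no_types, lifting) subset_trans)
qed

text \<open>The images of the blocks form the new signature; injectivity of \<open>f\<close>
  preserves their sizes. This carries the result from \<open>SU\<close> to its quotient by the
  trivial centre.\<close>

lemma mls_set_iso:
  assumes "mls_set G (carrier G)" "f \<in> iso G H" "group G" "group H"
  shows "mls_set H (carrier H)"
proof -
  interpret group_hom G H f
    using assms by (simp add: group_hom_def group_hom_axioms_def iso_def)
  have f: "inj_on f (carrier G)" "f ` carrier G = carrier H"
    using assms(2) by (auto simp: iso_def bij_betw_def)
  obtain As where As: "\<forall>A \<in> set As. A \<subseteq> carrier G"
      "bij_betw (list_prod G) {xs. list_all2 (\<in>) xs As} (carrier G)"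
      "ls_length As = mls_bound (card (carrier G))"
    using assms by (auto simp: mls_set_def)
  let ?Bs = "map ((`) f) As"
  have hom: "list_prod H (map f xs) = f (list_prod G xs)" if "set xs \<subseteq> carrier G" for xs
    using that by (induction xs) (auto simp: G.list_prod_closed)
  have lists: "{xs. list_all2 (\<in>) xs ?Bs} = map f ` {xs. list_all2 (\<in>) xs As}"
  proof (intro equalityI subsetI)
    fix ys assume "ys \<in> {xs. list_all2 (\<in>) xs ?Bs}"
    then have "list_all2 (\<lambda>y A. y \<in> f ` A) ys As"
      by (simp add: list_all2_map2)
    then have "\<exists>xs. ys = map f xs \<and> list_all2 (\<in>) xs As"
    proof (induction rule: list_all2_induct)
      case (Cons y ys A As)
      then obtain x xs where "y = f x" "x \<in> A" "ys = map f xs" "list_all2 (\<in>) xs As"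
        by blast
      then show ?case
        by (intro exI[of _ "x # xs"]) simp
    qed simp
    then show "ys \<in> map f ` {xs. list_all2 (\<in>) xs As}"
      by blast
  qed (auto simp: list_all2_map1 list_all2_map2 elim!: list_all2_mono)
  have car: "set xs \<subseteq> carrier G" if "list_all2 (\<in>) xs As" for xs
    using that As(1) by (rule list_all2_mem_carrier)
  have "bij_betw (f \<circ> list_prod G) {xs. list_all2 (\<in>) xs As} (carrier H)"
    using As(2) f by (intro bij_betw_trans[OF As(2)]) (auto simp: bij_betw_def)
  then have "bij_betw (list_prod H \<circ> map f) {xs. list_all2 (\<in>) xs As} (carrier H)"
    by (rule iffD1[OF bij_betw_cong, rotated]) (auto simp: hom car)
  then have "bij_betw (list_prod H) {xs. list_all2 (\<in>) xs ?Bs} (carrier H)"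
    unfolding lists by (auto simp: bij_betw_def inj_on_def image_comp)
  moreover have "ls_length ?Bs = ls_length As"
    using As(1) inj_on_subset[OF f(1)] unfolding ls_length_def
    by (auto intro!: arg_cong[where f = sum_list] card_image)
  moreover have "card (carrier H) = card (carrier G)"
    using f card_image by fastforce
  moreover have "finite (carrier H)"
    using assms(1) f(2) by (metis finite_imageI mls_set_def)
  moreover have "\<forall>A \<in> set ?Bs. A \<subseteq> carrier H"
    using As(1) f(2) by auto
  ultimately show ?thesis
    unfolding mls_set_def using As(3) by (intro conjI exI[of _ ?Bs]) auto
qed

section \<open>Exact factorisations from double cosets\<close>

lemma (in group) mls_set_double_cosets:
  assumes "finite (carrier G)" "subgroup H G" "subgroup B G" "mls_set G H" "mls_set G B"
    and int: "\<And>g h. g \<in> carrier G \<Longrightarrow> h \<in> H \<Longrightarrow> inv g \<otimes> h \<otimes> g \<in> B \<Longrightarrow> h = \<one>"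
    and "prime p" "order G = card H * p * card B"
  shows "mls_set G (carrier G)"
proof -
  interpret H: subgroup H G by fact
  interpret B: subgroup B G by fact
  note [simp] = H.subset[THEN subsetD] B.subset[THEN subsetD]
  have cancel [simp]: "inv x \<otimes> (x \<otimes> y) = y" if "x \<in> carrier G" "y \<in> carrier G" for x y
    using that by (simp add: m_assoc[symmetric])
  define dc where "dc g = (\<lambda>(h, b). h \<otimes> g \<otimes> b) ` (H \<times> B)" for g
  \<comment> \<open>Rearranging \<open>h g b = h' g b'\<close> puts the conjugate of
    \<open>inv h' h\<close> by \<open>g\<close> into \<open>B\<close>, so \<open>int\<close> makes
    it trivial. Every double coset therefore has exactly \<open>card H * card B\<close>
    elements.\<close>
  have free: "h = h' \<and> b = b'"
    if "g \<in> carrier G" "h \<in> H" "h' \<in> H" "b \<in> B" "b' \<in> B" "h \<otimes> g \<otimes> b = h' \<otimes> g \<otimes> b'"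
    for g h h' b b'
  proof -
    have "inv h' \<otimes> h \<otimes> g = inv h' \<otimes> ((h \<otimes> g \<otimes> b) \<otimes> inv b)"
      using that(1-5) by (simp add: m_assoc)
    also have "\<dots> = inv h' \<otimes> ((h' \<otimes> g \<otimes> b') \<otimes> inv b)"
      using that(6) by simp
    also have "\<dots> = g \<otimes> (b' \<otimes> inv b)"
      using that(1-5) by (simp add: m_assoc inv_solve_left')
    finally have "inv g \<otimes> (inv h' \<otimes> h) \<otimes> g = b' \<otimes> inv b"
      using that by (simp add: m_assoc inv_solve_left')
    then have "inv h' \<otimes> h = \<one>"
      using that int[of g "inv h' \<otimes> h"] by simp
    then have "h = h'"
      using that by (metis H.mem_carrier H.m_inv_closed inv_equality inv_inv)
    then show ?thesis
      using that by simp
  qed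
  have card_dc: "card (dc g) = card H * card B" if "g \<in> carrier G" for g
  proof -
    have "inj_on (\<lambda>(h, b). h \<otimes> g \<otimes> b) (H \<times> B)"
      using free[OF that] by (force intro: inj_onI)
    then show ?thesis
      by (simp add: dc_def card_image card_cartesian_product)
  qed
  have dc_mem: "h \<otimes> g \<otimes> b \<in> dc g" if "h \<in> H" "b \<in> B" for g h b
    using that by (auto simp: dc_def)
  have dc_self: "g \<in> dc g" if "g \<in> carrier G" for g
    using dc_mem[of \<one> \<one> g] that by simp
  have dc_sub: "dc x \<subseteq> dc y" if "x \<in> dc y" "y \<in> carrier G" for x y
  proof
    fix z assume "z \<in> dc x"
    then obtain h b h' b' where *: "h \<in> H" "b \<in> B" "z = h \<otimes> x \<otimes> b" "h' \<in> H" "b' \<in> B" "x = h' \<otimes> y \<otimes> b'"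
      using \<open>x \<in> dc y\<close> by (auto simp: dc_def)
    then have "z = (h \<otimes> h') \<otimes> y \<otimes> (b' \<otimes> b)"
      using that by (simp add: m_assoc)
    then show "z \<in> dc y"
      using * by (simp add: dc_mem)
  qed
  have dc_carrier: "dc g \<subseteq> carrier G" if "g \<in> carrier G" for g
    using that by (auto simp: dc_def)
  have dc_eq: "dc x = dc y" if xy: "x \<in> dc y" "y \<in> carrier G" for x y
  proof -
    obtain h b where *: "h \<in> H" "b \<in> B" "x = h \<otimes> y \<otimes> b"
      using xy by (auto simp: dc_def)
    then have "y = inv h \<otimes> x \<otimes> inv b"
      using xy by (simp add: m_assoc inv_solve_left')
    then have "y \<in> dc x"
      using * dc_mem[of "inv h" "inv b" x] by simp
    then show ?thesis
      using dc_sub xy dc_carrier by (meson subset_antisym subset_iff)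
  qed
  \<comment> \<open>One chosen element from each double coset; there are \<open>p\<close> of them by
    counting.\<close>
  define X where "X = inv_into (carrier G) dc ` (dc ` carrier G)"
  have X: "X \<subseteq> carrier G"
    by (auto simp: X_def intro: inv_into_into)
  have inj_X: "inj_on dc X"
    by (rule inj_onI) (auto simp: X_def f_inv_into_f inv_into_into)
  have "card (\<Union> (dc ` carrier G)) = card H * card B * card (dc ` carrier G)"
  proof (rule card_partition[symmetric])
    show "c1 \<inter> c2 = {}" if "c1 \<in> dc ` carrier G" "c2 \<in> dc ` carrier G" "c1 \<noteq> c2" for c1 c2
    proof (rule ccontr)
      assume "c1 \<inter> c2 \<noteq> {}"
      then obtain z where "z \<in> c1" "z \<in> c2"
        by blast
      with that dc_eq show False
        by (metis imageE)
    qed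
    show "finite (\<Union> (dc ` carrier G))"
      using assms(1) dc_carrier by (auto intro: finite_subset)
  qed (use assms(1) card_dc in auto)
  moreover have "\<Union> (dc ` carrier G) = carrier G"
    using dc_self dc_carrier by auto
  ultimately have "card H * p * card B = card H * card B * card (dc ` carrier G)"
    using assms(8) by (auto simp: order_def)
  moreover have "card H > 0" "card B > 0"
    using assms(4,5) by (auto simp: mls_set_def card_gt_0_iff)
  ultimately have "card (dc ` carrier G) = p"
    by auto
  moreover have "card X = card (dc ` carrier G)"
    unfolding X_def by (rule card_image) (rule inj_on_inv_into, simp)
  ultimately have "mls_set G X"
    using X \<open>prime p\<close> by (intro mls_set_prime) auto
  have same: "x = x'" if "x \<in> X" "x' \<in> X" "h \<in> H" "h' \<in> H" "b \<in> B" "b' \<in> B"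
      "h \<otimes> x \<otimes> b = h' \<otimes> x' \<otimes> b'" for h h' x x' b b'
  proof -
    have "x \<in> carrier G" "x' \<in> carrier G"
      using that X by auto
    then have "dc x = dc x'"
      using that dc_eq dc_mem by metis
    then show ?thesis
      using that inj_X by (auto dest: inj_onD)
  qed
  have "inj_on (\<lambda>(s, t). s \<otimes> t) (H \<times> X)"
  proof (rule inj_onI; clarify)
    fix h x h' x' assume *: "h \<in> H" "x \<in> X" "h' \<in> H" "x' \<in> X" "h \<otimes> x = h' \<otimes> x'"
    then have "x \<in> carrier G" "x' \<in> carrier G" 
      using X by auto
    with * have "x = x'"
      using same[of x x' h h' \<one> \<one>] by simp
    then show "h = h' \<and> x = x'"
      using * \<open>x \<in> carrier G\<close> by simp
  qed
  then have HX: "mls_set G (H <#> X)" "card (H <#> X) = card H * card X"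
    using mls_set_mult \<open>mls_set G X\<close> assms(4) by blast+
  have "inj_on (\<lambda>(s, t). s \<otimes> t) ((H <#> X) \<times> B)"
  proof (rule inj_onI; clarify)
    fix s b s' b' assume "s \<in> H <#> X" "b \<in> B" "s' \<in> H <#> X" "b' \<in> B" "s \<otimes> b = s' \<otimes> b'"
    then obtain h x h' x' where "h \<in> H" "x \<in> X" "h' \<in> H" "x' \<in> X" "s = h \<otimes> x" "s' = h' \<otimes> x'"
      by (auto simp: set_mult_def)
    then show "s = s' \<and> b = b'"
      using same free X \<open>s \<otimes> b = s' \<otimes> b'\<close> \<open>b \<in> B\<close> \<open>b' \<in> B\<close> by (metis subset_iff)
  qed
  then have HXB: "mls_set G (H <#> X <#> B)" "card (H <#> X <#> B) = card H * card X * card B"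
    using mls_set_mult HX assms(5) by auto
  \<comment> \<open>Uniqueness of factorisation is already known, so existence follows by comparing
    cardinalities.\<close>
  have "H <#> X <#> B = carrier G"
    using HXB \<open>card X = _\<close> \<open>card (dc ` carrier G) = p\<close> assms(1,8) mls_set_subset_carrier
    by (intro card_subset_eq) (auto simp: order_def)
  then show ?thesis
    using HXB by simp
qed

text \<open>With \<open>H\<close> trivial the double cosets are the left cosets of
  \<open>B\<close>.\<close>

lemma (in group) mls_set_prime_index:
  assumes "finite (carrier G)" "subgroup B G" "mls_set G B" "prime p" "order G = p * card B"
  shows "mls_set G (carrier G)"
  using assms
  by (intro mls_set_double_cosets[of "{\<one>}" B p]) (auto simp: triv_subgroup mls_set_one)

section \<open>Groups of prime power order and abelian groups\<close>

lemma mls_set_prime_power_order: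
  assumes "group G" "finite (carrier G)" "prime p" "order G = p ^ k"
  shows "mls_set G (carrier G)"
  using assms
proof (induction k arbitrary: G)
  case 0
  then have "carrier G = {\<one>\<^bsub>G\<^esub>}"
    by (metis card_1_singletonE group.is_monoid monoid.one_closed order_def power_0 singletonD)
  then show ?case
    using mls_set_one[of G] by simp
next
  case (Suc k)
  \<comment> \<open>Sylow's theorem for the non-maximal exponent \<open>k\<close> yields a subgroup
    of index \<open>p\<close>.\<close>
  obtain K where K: "subgroup K G" "card K = p ^ k"
    using sylow_thm[of p G k p] Suc.prems by auto
  then have "K \<subseteq> carrier G"
    by (auto simp: subgroup_def)
  have "mls_set (G\<lparr>carrier := K\<rparr>) (carrier (G\<lparr>carrier := K\<rparr>))"
    using K Suc.prems \<open>K \<subseteq> carrier G\<close>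
    by (intro Suc.IH) (auto simp: group.subgroup_imp_group order_def intro: finite_subset)
  then have "mls_set G K"
    using mls_set_subgroup \<open>K \<subseteq> carrier G\<close> by auto
  then show ?case
    using K Suc.prems by (intro group.mls_set_prime_index[of G K p]) auto
qed

lemma (in group) mls_set_prime_power_subgroup:
  assumes "subgroup K G" "prime p" "card K = p ^ k"
  shows "mls_set G K"
proof -
  have "finite K"
    using assms by (intro card_ge_0_finite) (simp add: prime_gt_0_nat)
  then have "mls_set (G\<lparr>carrier := K\<rparr>) K"
    using mls_set_prime_power_order[of "G\<lparr>carrier := K\<rparr>" p k] assms
    by (simp add: subgroup_imp_group order_def)
  then show ?thesis
    using mls_set_subgroup assms(1) subgroup.subset by blast
qed

lemma (in group) subgroup_card_pow_eq_one:
  assumes "subgroup K G" "finite K" "x \<in> K"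
  shows "x [^] card K = \<one>"
proof -
  interpret K: group "G\<lparr>carrier := K\<rparr>"
    using assms(1) by (rule subgroup_imp_group)
  show ?thesis
    using K.pow_order_eq_1[of x] assms by (simp add: order_def nat_pow_consistent[symmetric])
qed

lemma (in group) pow_coprime_eq_one:
  assumes "x \<in> carrier G" "x [^] (a::nat) = \<one>" "x [^] (b::nat) = \<one>" "coprime a b"
  shows "x = \<one>"
proof -
  have "ord x dvd a" "ord x dvd b"
    using assms by (simp_all add: pow_eq_id)
  then have "ord x = 1"
    using assms(4) coprime_common_divisor_nat by blast
  then show ?thesis
    using assms(1) pow_ord_eq_1[of x] by simp
qed

text \<open>The subgroup is a product of subgroups of order \<open>p ^ multiplicity p d\<close>, one
  for each prime \<open>p\<close> dividing \<open>d\<close>. Coprime orders make the factors meet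
  trivially, and commutativity makes the product a subgroup. The case of a proper divisor
  \<open>d\<close> later produces the Singer-type subgroup.\<close>

lemma (in comm_group) ex_mls_subgroup_of_order:
  assumes "finite (carrier G)" "d dvd order G"
  shows "\<exists>K. subgroup K G \<and> card K = d \<and> mls_set G K"
proof -
  have "order G > 0"
    using assms(1) by (auto simp: order_gt_0_iff_finite)
  then have "d > 0"
    using assms(2) by (auto intro: gr0I)
  have "\<exists>K. subgroup K G \<and> card K = (\<Prod>p\<in>P. p ^ multiplicity p d) \<and> mls_set G K"
    if "finite P" "P \<subseteq> prime_factors d" for P
    using that
  proof (induction P rule: finite_induct)
    case empty
    show ?case
      by (intro exI[of _ "{\<one>}"]) (simp add: triv_subgroup mls_set_one)
  next
    case (insert p P)
    then obtain K where K: "subgroup K G" "card K = (\<Prod>p\<in>P. p ^ multiplicity p d)" "mls_set G K"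
      by auto
    have "prime p"
      using insert.prems by auto
    have "p ^ multiplicity p d dvd order G"
      using assms(2) multiplicity_dvd dvd_trans by blast
    \<comment> \<open>\<open>sylow_thm\<close> applies to any power of \<open>p\<close> dividing the
      order, not only to the full one.\<close>
    then obtain S where S: "subgroup S G" "card S = p ^ multiplicity p d"
      using sylow_thm[OF \<open>prime p\<close> is_group _ assms(1)] by (metis dvdE)
    have "mls_set G S"
      using S \<open>prime p\<close> mls_set_prime_power_subgroup by blast
    have "coprime (card K) (card S)"
      unfolding K(2) S(2)
    proof (rule prod_coprime_left)
      fix p' assume "p' \<in> P"
      then have "prime p'" "p' \<noteq> p"
        using insert by auto
      then show "coprime (p' ^ multiplicity p' d) (p ^ multiplicity p d)"
        using \<open>prime p\<close> by (simp add: primes_coprime)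
    qed
    have fin: "finite K" "finite S"
      using K(3) \<open>mls_set G S\<close> by (auto simp: mls_set_def)
    have KS: "x = \<one>" if "x \<in> K" "x \<in> S" for x
      using that fin K S \<open>coprime (card K) (card S)\<close> 
      by (metis pow_coprime_eq_one subgroup.mem_carrier subgroup_card_pow_eq_one)
    have "inj_on (\<lambda>(s, t). s \<otimes> t) (K \<times> S)"
    proof (rule inj_onI; clarify)
      fix x s x' s' assume *: "x \<in> K" "s \<in> S" "x' \<in> K" "s' \<in> S" "x \<otimes> s = x' \<otimes> s'"
      have c: "x \<in> carrier G" "x' \<in> carrier G" "s \<in> carrier G" "s' \<in> carrier G"
        using * K S by (auto dest: subgroup.mem_carrier)
      have "inv x' \<otimes> x = s' \<otimes> inv s"
        using c *(5) by (metis inv_closed inv_solve_left inv_solve_right m_assoc m_closed)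
      moreover have "inv x' \<otimes> x \<in> K" "s' \<otimes> inv s \<in> S"
        using * K S by (auto intro: subgroup.m_closed subgroup.m_inv_closed)
      ultimately have "inv x' \<otimes> x = \<one>"
        using KS by simp
      then have "x = x'"
        using c by (metis inv_closed inv_equality inv_inv)
      then show "x = x' \<and> s = s'"
        using * c by simp
    qed
    then have "mls_set G (K <#> S)" "card (K <#> S) = card K * card S"
      using mls_set_mult K(3) \<open>mls_set G S\<close> by blast+
    moreover have "subgroup (K <#> S) G"
      using K S by (simp add: mult_subgroups)
    ultimately show ?case
      using insert K S by (intro exI[of _ "K <#> S"]) simp
  qed
  from this[of "prime_factors d"] show ?thesis
    using \<open>d > 0\<close> by (simp add: prime_factorization_nat[symmetric])
qed

lemma (in group) mls_set_commutative_subgroup: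
  assumes "subgroup K G" "finite K" "\<And>x y. x \<in> K \<Longrightarrow> y \<in> K \<Longrightarrow> x \<otimes> y = y \<otimes> x"
  shows "mls_set G K"
proof -
  interpret K: comm_group "G\<lparr>carrier := K\<rparr>"
    using assms by (intro group.group_comm_groupI subgroup_imp_group) auto
  obtain L where L: "subgroup L (G\<lparr>carrier := K\<rparr>)" "card L = card K" "mls_set (G\<lparr>carrier := K\<rparr>) L"
    using K.ex_mls_subgroup_of_order[of "card K"] assms(2) by (auto simp: order_def)
  have "L = K"
    using L(1,2) assms(2) subgroup.subset[OF L(1)] by (intro card_subset_eq) auto
  then show ?thesis
    using L(3) assms(1) mls_set_subgroup subgroup.subset by blast
qed

section \<open>Hermitian forms over a field of order \<open>q\<^sup>2\<close>, \<open>q\<close> even\<close>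

text \<open>With \<open>k * m\<close> points, at most \<open>m\<close> targets and at most
  \<open>k\<close> points over each, no fibre can be smaller than \<open>k\<close>. This turns root
  bounds for polynomials into exact fibre sizes of trace and norm.\<close>

lemma card_fibre_eq_if_bounded:
  fixes f :: "'a \<Rightarrow> 'b"
  assumes "finite A" "finite B" "f ` A \<subseteq> B" "card A = k * m" "card B \<le> m"
    and le: "\<And>b. b \<in> B \<Longrightarrow> card {a \<in> A. f a = b} \<le> k" and "b \<in> B"
  shows "card {a \<in> A. f a = b} = k"
proof (rule ccontr)
  assume "card {a \<in> A. f a = b} \<noteq> k"
  then have "card {a \<in> A. f a = b} < k"
    using le[OF \<open>b \<in> B\<close>] by simp
  have "card A = (\<Sum>b\<in>B. card {a \<in> A. f a = b})"
    using assms(1-3) by (subst card_eq_sum, subst sum.group[symmetric, of A B f]) simp_all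
  also have "\<dots> < (\<Sum>b\<in>B. k)"
    using assms(2) le \<open>b \<in> B\<close> \<open>card {a \<in> A. f a = b} < k\<close> by (intro sum_strict_mono_ex1) auto
  also have "\<dots> \<le> k * m"
    using assms(5) by simp
  finally show False
    using assms(4) by simp
qed

text \<open>Roots of \<open>x^k + a x - c\<close>, which has degree \<open>k\<close> because
  \<open>k >= 2\<close> keeps the linear term away from the leading one. The case
  \<open>a = 1\<close> serves the trace and the fixed field, \<open>a = 0\<close> the norm.\<close>

lemma card_solutions_pow_add_linear_le:
  fixes a c :: "'a::{field, finite}"
  assumes "k \<ge> 2"
  shows "card {x. x ^ k + a * x = c} \<le> k"
proof -
  let ?p = "Polynomial.monom 1 k + [:-c, a:]"
  have deg: "Polynomial.degree ?p = k"
    using assms by (subst degree_add_eq_left) (auto simp: Polynomial.degree_monom_eq)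
  then have "?p \<noteq> 0"
    using assms by auto
  then have "card {x. poly ?p x = 0} \<le> k"
    using card_poly_roots_bound deg by metis
  moreover have "{x. poly ?p x = 0} = {x. x ^ k + a * x = c}"
    by (auto simp: Polynomial.poly_monom algebra_simps eq_neg_iff_add_eq_0 add_eq_0_iff)
  ultimately show ?thesis
    by simp
qed

lemma power_coprime_eq_one:
  fixes x :: "'a::monoid_mult"
  assumes "x ^ a = 1" "x ^ b = 1" "coprime a b" "a > 0"
  shows "x = 1"
proof -
  obtain s t where "a * s = b * t + 1"
    using bezout_nat[of a b] assms(3,4) by (auto simp: coprime_iff_gcd_eq_1)
  moreover have "x ^ (a * s) = 1" "x ^ (b * t + 1) = x"
    using assms(1,2) by (simp_all add: power_mult)
  ultimately show ?thesis
    by simp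
qed

text \<open>Multiplication by \<open>a\<close> permutes the nonzero elements, so it leaves their
  product unchanged.\<close>

lemma field_power_card_minus_1:
  fixes a :: "'a::{field, finite}"
  assumes "a \<noteq> 0"
  shows "a ^ (CARD('a) - 1) = 1"
proof -
  let ?U = "UNIV - {0 :: 'a}"
  have "prod (\<lambda>x. x) ?U = prod (\<lambda>x. a * x) ?U"
    using assms by (intro prod.reindex_bij_witness[of _ "\<lambda>x. a * x" "\<lambda>x. x / a"]) auto
  also have "\<dots> = a ^ card ?U * prod (\<lambda>x. x) ?U"
    by (simp add: prod.distrib)
  finally show ?thesis
    by (simp add: card_Diff_singleton)
qed

text \<open>The \<open>itself\<close> parameter ties the field type to the locale, since
  \<open>n\<close> and \<open>q\<close> do not mention it.\<close>

locale even_hermitian_field =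
  fixes n q :: nat and field_type :: "'a::{field, finite} itself"
  assumes q_eq: "q = 2 ^ n" and n_pos: "n > 0" and card_field: "CARD('a) = q ^ 2"
begin

lemma q_ge_2: "q \<ge> 2"
  using q_eq n_pos by (metis one_le_numeral power_increasing power_one_right Suc_leI One_nat_def)

lemma q_squared_gt_1: "q\<^sup>2 > 1"
  using q_ge_2 by (intro one_less_power) auto

text \<open>Adding 1 permutes the field, so the sum of \<open>CARD('a)\<close> ones is 0; this
  number is a power of 2, and a field has no nonzero nilpotent elements.\<close>

lemma two_eq_0 [simp]: "(2 :: 'a) = 0"
proof -
  have "(\<Sum>x\<in>UNIV. x) = (\<Sum>x\<in>UNIV. x + 1 :: 'a)"
    by (intro sum.reindex_bij_witness[of _ "\<lambda>x. x + 1" "\<lambda>x. x - 1"]) auto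
  then have "of_nat CARD('a) = (0 :: 'a)"
    by (simp add: sum.distrib)
  then show ?thesis
    by (simp add: card_field q_eq)
qed

lemma add_self [simp]: "x + x = (0 :: 'a)"
  by (simp flip: mult_2)

lemma add_self_left [simp]: "x + (x + y) = (y :: 'a)"
  by (simp flip: add.assoc)

lemma uminus_eq [simp]: "- x = (x :: 'a)"
  by (simp add: minus_unique)

lemma minus_eq_plus [simp]: "x - y = (x + y :: 'a)"
  by (metis uminus_eq diff_conv_add_uminus)

lemma add_eq_0_iff_eq [simp]: "x + y = (0 :: 'a) \<longleftrightarrow> x = y"
  by (metis add_self add_right_cancel)

lemma power_two_power_add: "(x + y :: 'a) ^ (2 ^ k) = x ^ (2 ^ k) + y ^ (2 ^ k)"
proof (induction k)
  case (Suc k)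
  have "(x + y) ^ (2 ^ Suc k) = ((x + y) ^ (2 ^ k))\<^sup>2"
    by (simp add: power_mult[symmetric] mult.commute)
  also have "\<dots> = (x ^ (2 ^ k))\<^sup>2 + (y ^ (2 ^ k))\<^sup>2"
    by (simp add: Suc power2_sum)
  also have "\<dots> = x ^ (2 ^ Suc k) + y ^ (2 ^ Suc k)"
    by (simp add: power_mult[symmetric] mult.commute)
  finally show ?case .
qed simp

lemma frob_add: "(x + y :: 'a) ^ q = x ^ q + y ^ q"
  by (simp add: q_eq power_two_power_add)

lemma frob_sum: "(\<Sum>i\<in>I. f i :: 'a) ^ q = (\<Sum>i\<in>I. f i ^ q)"
  using q_ge_2 by (induction I rule: infinite_finite_induct) (auto simp: frob_add)

lemma pow_card_minus_1: "x \<noteq> 0 \<Longrightarrow> (x :: 'a) ^ (q\<^sup>2 - 1) = 1"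
  using field_power_card_minus_1[of x] by (simp add: card_field)

lemma card_units: "card (UNIV - {0 :: 'a}) = q\<^sup>2 - 1"
  by (simp add: card_Diff_singleton card_field)

lemma pow_q_q [simp]: "((x :: 'a) ^ q) ^ q = x"
proof (cases "x = 0")
  case False
  have "(x ^ q) ^ q = x ^ (q\<^sup>2 - 1) * x"
    using q_ge_2 by (simp add: power_mult[symmetric] power2_eq_square flip: power_Suc2)
  then show ?thesis
    using pow_card_minus_1[OF False] by simp
qed (use q_ge_2 in auto)

lemma frob_eq_0_iff [simp]: "(x :: 'a) ^ q = 0 \<longleftrightarrow> x = 0"
  using q_ge_2 by simp

text \<open>The trace sends the \<open>q * q\<close> field elements to the at most \<open>q\<close>
  fixed points of the Frobenius map, with at most \<open>q\<close> elements over each.\<close>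

lemma card_trace_fibre:
  assumes "(c :: 'a) ^ q = c"
  shows "card {t. t ^ q + t = c} = q"
proof -
  have "card {t \<in> UNIV. t ^ q + t = c} = q"
  proof (rule card_fibre_eq_if_bounded[where B = "{c. c ^ q = c}" and m = q])
    show "card (UNIV :: 'a set) = q * q"
      by (simp add: card_field power2_eq_square)
    show "card {c :: 'a. c ^ q = c} \<le> q"
      using card_solutions_pow_add_linear_le[of q "1 :: 'a" 0] q_ge_2 by simp
    show "card {t \<in> UNIV. t ^ q + t = b} \<le> q" for b :: 'a
      using card_solutions_pow_add_linear_le[of q "1 :: 'a" b] q_ge_2 by simp
  qed (use assms in \<open>auto simp: frob_add add.commute\<close>)
  then show ?thesis
    by simp
qed

lemma norm_frob: "((x :: 'a) ^ (q + 1)) ^ q = x ^ (q + 1)"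
  by (simp add: power_mult_distrib)

text \<open>The same count for the norm: \<open>(q + 1) * (q - 1)\<close> units, at most
  \<open>q - 1\<close> nonzero fixed points, at most \<open>q + 1\<close> roots over each.\<close>

lemma card_norm_fibre:
  assumes "(c :: 'a) ^ q = c" "c \<noteq> 0"
  shows "card {x. x ^ (q + 1) = c} = q + 1"
proof -
  have *: "{c :: 'a. c ^ q = c \<and> c \<noteq> 0} = {c. c ^ q + 1 * c = 0} - {0}"
    by auto
  have "card {x \<in> UNIV - {0}. x ^ (q + 1) = c} = q + 1"
  proof (rule card_fibre_eq_if_bounded[where B = "{c. c ^ q = c \<and> c \<noteq> 0}" and m = "q - 1"])
    show "card (UNIV - {0 :: 'a}) = (q + 1) * (q - 1)"
      using q_ge_2 by (simp add: card_Diff_singleton card_field power2_eq_square algebra_simps)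
    show "card {c :: 'a. c ^ q = c \<and> c \<noteq> 0} \<le> q - 1"
      unfolding * using card_solutions_pow_add_linear_le[of q "1 :: 'a" 0] q_ge_2
      by (subst card_Diff_singleton) (auto simp: diff_le_mono)
    show "card {x \<in> UNIV - {0}. x ^ (q + 1) = b} \<le> q + 1" for b :: 'a
    proof -
      have "card {x \<in> UNIV - {0}. x ^ (q + 1) = b} \<le> card {x. x ^ (q + 1) + 0 * x = b}"
        by (intro card_mono) auto
      also have "\<dots> \<le> q + 1"
        using q_ge_2 by (intro card_solutions_pow_add_linear_le) auto
      finally show ?thesis .
    qed
  qed (use assms in \<open>auto simp: norm_frob[simplified]\<close>)
  moreover have "{x \<in> UNIV - {0}. x ^ (q + 1) = c} = {x. x ^ (q + 1) = c}"
    using assms by auto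
  ultimately show ?thesis
    by simp
qed

section \<open>The Hermitian form and its isotropic vectors\<close>

definition herm :: "'a ^ 3 \<Rightarrow> 'a ^ 3 \<Rightarrow> 'a" where
  "herm x y = (\<Sum>i\<in>UNIV. x $ i * (y $ i) ^ q)"

lemma herm_3: "herm x y = x $ 1 * (y $ 1) ^ q + x $ 2 * (y $ 2) ^ q + x $ 3 * (y $ 3) ^ q"
  by (simp add: herm_def sum_3)

lemma herm_add_left: "herm (x + y) z = herm x z + herm y z"
  by (simp add: herm_def sum.distrib algebra_simps)

lemma herm_scale_left: "herm (c *s x) z = c * herm x z"
  by (simp add: herm_def sum_distrib_left algebra_simps)

lemma herm_commute: "herm y x = (herm x y) ^ q"
  by (simp add: herm_def frob_sum power_mult_distrib mult.commute)

lemma herm_add_right: "herm z (x + y) = herm z x + herm z y"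
  by (simp add: herm_def sum.distrib algebra_simps frob_add)

lemma herm_scale_right: "herm z (c *s x) = c ^ q * herm z x"
  by (simp add: herm_def sum_distrib_left algebra_simps power_mult_distrib)

lemma ex_herm_eq_1:
  assumes "x \<noteq> 0"
  shows "\<exists>y. herm y x = 1"
proof -
  obtain i where i: "x $ i \<noteq> 0"
    using assms by (auto simp: vec_eq_iff)
  have "herm (axis i (inverse (x $ i ^ q))) x = 1"
    using i by (simp add: herm_def axis_def if_distrib[of "\<lambda>u. u * _"] cong: if_cong)
  then show ?thesis ..
qed

text \<open>The \<open>q^2\<close> fibres of the linear map \<open>herm _ x\<close> are translates
  of each other and partition a space of \<open>q^6\<close> vectors.\<close>

lemma card_herm_eq_1:
  assumes "x \<noteq> 0"
  shows "card {y. herm y x = 1} = q ^ 4"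
proof -
  obtain y0 where y0: "herm y0 x = 1"
    using ex_herm_eq_1[OF assms] by blast
  have fibre: "card {y. herm y x = c} = card {y. herm y x = 1}" for c
  proof -
    \<comment> \<open>Translation by \<open>(c + 1) *s y0\<close> exchanges the values
      \<open>c\<close> and 1; in characteristic 2 it is its own inverse.\<close>
    let ?f = "\<lambda>y. y + (c + 1) *s y0"
    have invol: "?f (?f y) = y" for y
      by (simp add: vec_eq_iff add.assoc)
    have "herm (?f y) x = herm y x + (c + 1)" for y
      by (simp add: herm_add_left herm_scale_left y0)
    then show ?thesis
      by (intro bij_betw_same_card[of ?f] bij_betw_byWitness[where f' = ?f])
         (auto simp: invol add.assoc[symmetric])
  qed
  have "(\<Sum>c\<in>UNIV. card {y. herm y x = c}) = q\<^sup>2 * card {y. herm y x = 1}"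
    by (subst sum.cong[OF refl fibre]) (simp add: card_field)
  moreover have "(\<Sum>c\<in>UNIV. card {y. herm y x = c}) = card (UNIV :: ('a ^ 3) set)"
    using sum.group[of "UNIV :: ('a ^ 3) set" UNIV "\<lambda>y. herm y x" "\<lambda>_. 1 :: nat"]
    by simp
  moreover have "card (UNIV :: ('a ^ 3) set) = q\<^sup>2 * q ^ 4"
    by (simp add: card_field flip: power_add power_mult)
  ultimately have "q\<^sup>2 * card {y. herm y x = 1} = q\<^sup>2 * q ^ 4"
    by metis
  then show ?thesis
    using q_ge_2 by (simp only: mult_cancel1) auto
qed

text \<open>
  The translations \<open>y \<mapsto> y + t x\<close> preserve the condition \<open>herm x y = 1\<close> and shift \<open>herm y y\<close> by the
  trace of \<open>t\<close>, so each of the \<open>q\<^sup>2\<close> classes of \<open>q\<^sup>2\<close> vectors contains exactly \<open>q\<close> isotropic ones.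
\<close>

lemma card_hyperbolic_partners:
  assumes "x \<noteq> 0" "herm x x = 0"
  shows "card {y. herm y y = 0 \<and> herm x y = 1} = q ^ 3"
proof -
  have sym: "herm x y = 1 \<longleftrightarrow> herm y x = 1" for y
    by (metis herm_commute power_one)
  let ?Y = "{y. herm y x = 1}" and ?I = "{y. herm y y = 0 \<and> herm x y = 1}"
  \<comment> \<open>Double counting of the pairs \<open>(y, t)\<close> for which
    \<open>y + t *s x\<close> is isotropic: choosing \<open>y\<close> first gives
    \<open>q^4 * q\<close> pairs, choosing \<open>y + t *s x\<close> first leaves \<open>t\<close>
    free and gives \<open>card ?I * q^2\<close>.\<close>
  let ?P = "SIGMA y:?Y. {t. t ^ q + t = herm y y}"
  have move: "herm (y + t *s x) (y + t *s x) = herm y y + (t ^ q + t)" if "herm y x = 1" for y t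
    using that sym[of y] assms(2)
    by (simp add: herm_add_left herm_add_right herm_scale_left herm_scale_right)
  have "card ?P = (\<Sum>y\<in>?Y. q)"
    by (subst card_SigmaI) (auto intro!: sum.cong card_trace_fibre simp: herm_commute[symmetric]
        simp del: sum_constant)
  also have "\<dots> = q ^ 5"
    using assms by (simp add: card_herm_eq_1 flip: power_Suc2)
  finally have "card ?P = q ^ 5" .
  moreover have "card ?P = card (?I \<times> (UNIV :: 'a set))"
  proof (rule bij_betw_same_card[of "\<lambda>(y, t). (y + t *s x, t)"],
      rule bij_betw_byWitness[where f' = "\<lambda>(y, t). (y - t *s x, t)"])
    show "\<forall>p\<in>?P. (\<lambda>(y, t). (y - t *s x, t)) ((\<lambda>(y, t). (y + t *s x, t)) p) = p"
      by auto
    show "\<forall>p\<in>?I \<times> UNIV. (\<lambda>(y, t). (y + t *s x, t)) ((\<lambda>(y, t). (y - t *s x, t)) p) = p"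
      by auto
    show "(\<lambda>(y, t). (y + t *s x, t)) ` ?P \<subseteq> ?I \<times> UNIV"
    proof
      fix p assume "p \<in> (\<lambda>(y, t). (y + t *s x, t)) ` ?P"
      then obtain y t where p: "p = (y + t *s x, t)" and y: "herm y x = 1" "t ^ q + t = herm y y"
        by auto
      show "p \<in> ?I \<times> UNIV"
        unfolding p using move[OF y(1), of t] y by (simp add: sym) (simp add: herm_add_left herm_scale_left assms)
    qed
    show "(\<lambda>(y, t). (y - t *s x, t)) ` (?I \<times> UNIV) \<subseteq> ?P"
    proof
      fix p assume "p \<in> (\<lambda>(y, t). (y - t *s x, t)) ` (?I \<times> UNIV)"
      then obtain y t where p: "p = (y - t *s x, t)" and y: "herm y y = 0" "herm x y = 1"
        by auto
      have *: "y - t *s x = y + t *s x"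
        by (simp add: vec_eq_iff)
      show "p \<in> ?P"
        unfolding p * using y move[of y t] assms by (simp add: sym herm_add_left herm_scale_left)
    qed
  qed
  ultimately have "card ?I * q\<^sup>2 = q ^ 3 * q\<^sup>2"
    by (simp add: card_cartesian_product card_field flip: power_add)
  then show ?thesis
    using q_ge_2 by (simp only: mult_cancel2) auto
qed

text \<open>In characteristic 2 a vector is isotropic when the norm of the third coordinate is the
  sum of the norms of the other two. That sum is 0 or has \<open>q + 1\<close> preimages, so the
  count depends only on whether the first two norms agree. The zero vector is removed at the
  end.\<close>

lemma card_isotropic:
  "card {x. x \<noteq> 0 \<and> herm x x = 0} = (q ^ 3 + 1) * (q\<^sup>2 - 1)"
proof -
  let ?N = "\<lambda>x :: 'a. x ^ (q + 1)"
  let ?V = "SIGMA a:UNIV. SIGMA b:UNIV. {c. ?N c = ?N a + ?N b}"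
  have fibre: "card {c. ?N c = ?N a + ?N b} = (if ?N b = ?N a then 1 else q + 1)" for a b
  proof (cases "?N b = ?N a")
    case True
    then have "{c. ?N c = ?N a + ?N b} = {0}"
      by auto
    then show ?thesis
      using True by simp
  next
    case False
    have "(?N a + ?N b) ^ q = ?N a + ?N b"
      by (simp only: frob_add norm_frob)
    moreover have "?N a + ?N b \<noteq> 0"
      using False by (metis add_eq_0_iff_eq)
    ultimately show ?thesis
      using False card_norm_fibre by metis
  qed
  have sum_b: "(\<Sum>b\<in>UNIV. card {c. ?N c = ?N a + ?N b}) =
      (if a = 0 then 1 + (q\<^sup>2 - 1) * (q + 1) else (q + 1) * (q\<^sup>2 - q))" for a
  proof -
    let ?S = "{b. ?N b = ?N a}"
    have "(\<Sum>b\<in>UNIV. card {c. ?N c = ?N a + ?N b}) = (\<Sum>b\<in>UNIV. if b \<in> ?S then 1 else q + 1)"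
      by (simp only: fibre mem_Collect_eq)
    also have "\<dots> = card ?S + (q\<^sup>2 - card ?S) * (q + 1)"
      by (subst sum.If_cases)
         (simp_all add: card_Diff_subset card_field Compl_eq_Diff_UNIV)
    finally have *: "(\<Sum>b\<in>UNIV. card {c. ?N c = ?N a + ?N b}) =
      card ?S + (q\<^sup>2 - card ?S) * (q + 1)" .
    show ?thesis
    proof (cases "a = 0")
      case True
      then have "?S = {0}"
        by auto
      then show ?thesis
        using * True by simp
    next
      case False
      then have "card ?S = q + 1"
        by (intro card_norm_fibre norm_frob) simp
      \<comment> \<open>Writing \<open>q^2 = q + 1 + e\<close> removes the truncated subtractions;
        here \<open>1 + e = q^2 - q\<close>.\<close>
      moreover obtain e where "q\<^sup>2 = q + 1 + e"
      proof -
        obtain k where "q = 2 + k"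
          using q_ge_2 le_Suc_ex by blast
        then have "q + 1 \<le> q\<^sup>2"
          by (simp add: power2_eq_square)
        then show ?thesis
          using that le_Suc_ex by blast
      qed
      ultimately show ?thesis
        using * False by (simp only: if_False) simp
    qed
  qed
  have factor: "A * B + A * (B * D) = A * B * (1 + D)" for A B D :: nat
    by (simp add: algebra_simps)
  have "card ?V = (\<Sum>a\<in>UNIV. \<Sum>b\<in>UNIV. card {c. ?N c = ?N a + ?N b})"
    by (simp only: card_SigmaI[OF finite ballI[OF finite]])
  also have "\<dots> = 1 + (q\<^sup>2 - 1) * (q + 1) + (\<Sum>a\<in>UNIV - {0::'a}. (q + 1) * (q\<^sup>2 - q))"
    unfolding sum_b by (subst sum.remove[of _ 0]) auto
  also have "\<dots> = 1 + (q\<^sup>2 - 1) * (q + 1) * (1 + (q\<^sup>2 - q))"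
    by (simp only: sum_constant card_units of_nat_id add.assoc factor)
  also have "(q\<^sup>2 - 1) * (q + 1) * (1 + (q\<^sup>2 - q)) = (q ^ 3 + 1) * (q\<^sup>2 - 1)"
  proof -
    define d where "d = q\<^sup>2 - q"
    have d: "q * q = q + d"
      using q_ge_2 by (simp add: power2_eq_square d_def)
    have "q ^ 3 = q * (q * q)"
      by (simp add: power3_eq_cube)
    also have "\<dots> = q + d + q * d"
      unfolding d by (simp add: distrib_left d)
    finally have "(q + 1) * (1 + (q\<^sup>2 - q)) = q ^ 3 + 1"
      unfolding d_def[symmetric] by (simp add: algebra_simps)
    then show ?thesis
      by (simp only: mult.assoc) (rule mult.commute)
  qed
  finally have "card ?V = 1 + (q ^ 3 + 1) * (q\<^sup>2 - 1)" .
  moreover have "card {x. herm x x = 0} = card ?V"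
  proof -
    let ?f = "\<lambda>x :: 'a ^ 3. (x $ 1, x $ 2, x $ 3)"
    let ?g = "\<lambda>(a, b, c). vector [a, b, c] :: 'a ^ 3"
    show ?thesis
    proof (rule bij_betw_same_card[of ?f], rule bij_betw_byWitness[where f' = ?g])
      show "\<forall>x\<in>{x. herm x x = 0}. ?g (?f x) = x"
        by (simp add: vec_eq_iff forall_3)
      show "\<forall>p\<in>?V. ?f (?g p) = p"
        by auto
      show "?f ` {x. herm x x = 0} \<subseteq> ?V"
        by (auto simp: herm_3)
      show "?g ` ?V \<subseteq> {x. herm x x = 0}"
        by (auto simp: herm_3)
    qed
  qed
  moreover have "{x. x \<noteq> 0 \<and> herm x x = 0} = {x. herm x x = 0} - {0}"
    by auto
  moreover have "herm 0 0 = 0"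
    by (simp add: herm_3)
  ultimately show ?thesis
    by (simp add: card_Diff_singleton)
qed

end

section \<open>The special unitary group and its Borel subgroup\<close>

definition cols :: "'a ^ 3 \<Rightarrow> 'a ^ 3 \<Rightarrow> 'a ^ 3 \<Rightarrow> 'a ^ 3 ^ 3" where
  "cols x y z = (\<chi> i j. if j = 1 then x $ i else if j = 2 then y $ i else z $ i)"

lemma matrix_mult_cols:
  fixes A :: "'a::semiring_1 ^ 3 ^ 3"
  shows "A ** cols x y z = cols (A *v x) (A *v y) (A *v z)"
  by (simp add: cols_def matrix_matrix_mult_def matrix_vector_mult_def vec_eq_iff)

lemma cols_eq_iff: "cols x y z = cols x' y' z' \<longleftrightarrow> x = x' \<and> y = y' \<and> z = z'"
  by (auto simp: cols_def vec_eq_iff forall_3)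

context even_hermitian_field
begin

abbreviation star :: "'a ^ 3 ^ 3 \<Rightarrow> 'a ^ 3 ^ 3" where
  "star \<equiv> conj_transpose q"

abbreviation SU :: "('a ^ 3 ^ 3) monoid" where
  "SU \<equiv> SU3 q"

lemma star_mult: "star (A ** B) = star B ** star A"
  by (simp add: conj_transpose_def matrix_matrix_mult_def vec_eq_iff frob_sum power_mult_distrib
      mult.commute)

lemma star_star [simp]: "star (star A) = A"
  by (simp add: conj_transpose_def vec_eq_iff)

lemma star_one [simp]: "star (mat 1) = mat 1"
  using q_ge_2 by (simp add: conj_transpose_def mat_def vec_eq_iff)

lemma SU_mult [simp]: "A \<otimes>\<^bsub>SU\<^esub> B = A ** B" and SU_one [simp]: "\<one>\<^bsub>SU\<^esub> = mat 1"
  by (simp_all add: SU3_def)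

lemma mem_SU: "A \<in> carrier SU \<longleftrightarrow> det A = 1 \<and> star A ** A = mat 1"
  by (auto simp: SU3_def matrix_left_right_inverse)

lemma star_in_SU:
  assumes "A \<in> carrier SU"
  shows "star A \<in> carrier SU"
proof -
  have "det (star A) * det A = 1"
    using assms by (metis det_I det_mul mem_SU)
  then show ?thesis
    using assms by (auto simp: mem_SU matrix_left_right_inverse)
qed

lemma group_SU: "group SU"
proof (rule groupI)
  show "\<And>A B. A \<in> carrier SU \<Longrightarrow> B \<in> carrier SU \<Longrightarrow> A \<otimes>\<^bsub>SU\<^esub> B \<in> carrier SU"
    by (simp add: mem_SU det_mul star_mult)
       (metis matrix_mul_assoc matrix_mul_rid)
  show "\<exists>B\<in>carrier SU. B \<otimes>\<^bsub>SU\<^esub> A = \<one>\<^bsub>SU\<^esub>" if "A \<in> carrier SU" for A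
    using that star_in_SU by (intro bexI[of _ "star A"]) (simp_all add: mem_SU)
qed (auto simp: mem_SU matrix_mul_assoc)

sublocale SU: group SU
  by (rule group_SU)

lemma finite_SU: "finite (carrier SU)"
  by simp

lemma inv_SU:
  assumes "A \<in> carrier SU"
  shows "inv\<^bsub>SU\<^esub> A = star A"
  using assms star_in_SU by (intro SU.inv_equality) (simp_all add: mem_SU)

lemma herm_adjoint: "herm (A *v x) y = herm x (star A *v y)"
  unfolding herm_def conj_transpose_def matrix_vector_mult_def
  by (simp add: frob_sum power_mult_distrib sum_distrib_left sum_distrib_right mult_ac)
     (rule sum.swap)

lemma herm_SU:
  assumes "A \<in> carrier SU"
  shows "herm (A *v x) (A *v y) = herm x y"
  using assms by (simp add: mem_SU herm_adjoint matrix_vector_mul_assoc)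

lemma herm_nondegenerate:
  assumes "\<And>z. herm z x = herm z y"
  shows "x = y"
proof (rule ccontr)
  assume "x \<noteq> y"
  then have "x + y \<noteq> 0"
    by (auto simp: vec_eq_iff)
  then obtain z where "herm z (x + y) = 1"
    using ex_herm_eq_1 by blast
  then show False
    using assms[of z] by (simp add: herm_add_right)
qed

text \<open>
  The conjugate of the usual cross product, whose signs are irrelevant in characteristic 2.
\<close>

definition cross :: "'a ^ 3 \<Rightarrow> 'a ^ 3 \<Rightarrow> 'a ^ 3" where
  "cross x y = vector [(x $ 2 * y $ 3 + x $ 3 * y $ 2) ^ q, (x $ 3 * y $ 1 + x $ 1 * y $ 3) ^ q,
     (x $ 1 * y $ 2 + x $ 2 * y $ 1) ^ q]"

text \<open>The \<open>q\<close>-th powers in \<open>cross\<close> and in \<open>herm\<close>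
  cancel, leaving the expansion of the determinant along its first column.\<close>

lemma det_cols: "det (cols z x y) = herm z (cross x y)"
  by (simp add: det_3 cols_def herm_3 cross_def algebra_simps)

lemma herm_cross: "herm x (cross x y) = 0" "herm y (cross x y) = 0"
  by (simp_all add: herm_3 cross_def algebra_simps)

text \<open>Lagrange's identity for the Hermitian form, with the sign lost in characteristic
  2.\<close>

lemma herm_cross_cross:
  "herm (cross x y) (cross x y) = herm x x * herm y y + herm x y * herm y x"
  by (simp add: herm_3 cross_def algebra_simps frob_add power_mult_distrib)

lemma det_frame: "det (cols x y (cross x y)) = herm (cross x y) (cross x y)"
  by (simp add: det_cols[symmetric]) (simp add: det_3 cols_def algebra_simps)

text \<open>\<open>cross x y\<close> is determined by the determinants
  \<open>det (cols w x y)\<close>, which \<open>A\<close> preserves because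
  \<open>det A = 1\<close>.\<close>

lemma cross_SU:
  assumes "A \<in> carrier SU"
  shows "A *v cross x y = cross (A *v x) (A *v y)"
proof (rule herm_nondegenerate)
  fix z
  have z: "z = A *v (star A *v z)"
    using assms by (simp add: mem_SU matrix_left_right_inverse matrix_vector_mul_assoc)
  have "herm (A *v w) (cross (A *v x) (A *v y)) = herm w (cross x y)" for w
    using assms by (simp add: det_cols[symmetric] matrix_mult_cols[symmetric] det_mul mem_SU)
  then show "herm z (A *v cross x y) = herm z (cross (A *v x) (A *v y))"
    using assms z herm_SU by metis
qed

section \<open>Hyperbolic pairs and the simply transitive action on them\<close>

definition hyperbolic :: "'a ^ 3 \<Rightarrow> 'a ^ 3 \<Rightarrow> bool" where
  "hyperbolic x y \<longleftrightarrow> herm x x = 0 \<and> herm y y = 0 \<and> herm x y = 1"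

lemma hyperbolic_nonzero: "hyperbolic x y \<Longrightarrow> x \<noteq> 0"
  by (auto simp: hyperbolic_def herm_3)

lemma hyperbolic_SU: "A \<in> carrier SU \<Longrightarrow> hyperbolic x y \<Longrightarrow> hyperbolic (A *v x) (A *v y)"
  by (simp add: hyperbolic_def herm_SU)

lemma ex_hyperbolic: "\<exists>x y. hyperbolic x y"
proof -
  have "card {x. x \<noteq> 0 \<and> herm x x = 0} > 0"
    using q_squared_gt_1 by (simp only: card_isotropic nat_0_less_mult_iff) simp
  then obtain x where x: "x \<noteq> 0" "herm x x = 0"
    by (auto simp: card_gt_0_iff)
  then have "card {y. herm y y = 0 \<and> herm x y = 1} > 0"
    using q_ge_2 by (simp add: card_hyperbolic_partners)
  then show ?thesis
    using x by (auto simp: card_gt_0_iff hyperbolic_def)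
qed

text \<open>The Gram matrix does not depend on the pair, so the matrix carrying one such frame to
  another is unitary.\<close>

lemma gram_frame:
  assumes "hyperbolic x y"
  shows "star (cols x y (cross x y)) ** cols x y (cross x y) =
    (\<chi> i j. if i = 1 \<and> j = 2 \<or> i = 2 \<and> j = 1 \<or> i = 3 \<and> j = 3 then 1 else 0)"
proof -
  have "herm y x = 1"
    using assms by (metis herm_commute hyperbolic_def power_one)
  moreover have "herm (cross x y) z = (herm z (cross x y)) ^ q" for z
    by (rule herm_commute)
  ultimately have h: "herm x x = 0" "herm y y = 0" "herm x y = 1" "herm y x = 1"
      "herm x (cross x y) = 0" "herm y (cross x y) = 0"
      "herm (cross x y) x = 0" "herm (cross x y) y = 0" "herm (cross x y) (cross x y) = 1"
    using assms q_ge_2 by (simp_all add: hyperbolic_def herm_cross herm_cross_cross)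
  have "(star (cols x y z) ** cols x y z) $ i $ j =
      herm (if j = 1 then x else if j = 2 then y else z) (if i = 1 then x else if i = 2 then y else z)"
    for z i j
    by (simp add: matrix_matrix_mult_def conj_transpose_def cols_def herm_def mult.commute)
  then show ?thesis
    by (simp add: vec_eq_iff forall_3 h)
qed

lemma det_hyperbolic_frame:
  assumes "hyperbolic x y"
  shows "det (cols x y (cross x y)) = 1"
  using assms herm_commute[of y x]
  by (simp add: det_frame herm_cross_cross hyperbolic_def)

text \<open>By \<open>cross_SU\<close> the two matrices also agree on \<open>cross x y\<close>,
  hence on a basis.\<close>

lemma SU_eq_if_eq_on_hyperbolic:
  assumes "A \<in> carrier SU" "B \<in> carrier SU" "hyperbolic x y" "A *v x = B *v x" "A *v y = B *v y"
  shows "A = B"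
proof -
  let ?R = "cols x y (cross x y)"
  have "A ** ?R = B ** ?R"
    using assms by (simp add: matrix_mult_cols cross_SU)
  moreover obtain R' where "?R ** R' = mat 1"
    using det_hyperbolic_frame[OF assms(3)] by (metis invertible_def invertible_det_nz zero_neq_one)
  ultimately show ?thesis
    by (metis matrix_mul_assoc matrix_mul_rid)
qed

text \<open>The witness is the second frame times the inverse of the first; equal Gram matrices make
  it unitary, and both frames have determinant 1.\<close>

lemma ex_SU_moving_hyperbolic:
  assumes "hyperbolic u v" "hyperbolic x y"
  shows "\<exists>A \<in> carrier SU. A *v u = x \<and> A *v v = y"
proof -
  let ?R = "cols u v (cross u v)" and ?S = "cols x y (cross x y)"
  obtain R' where R': "?R ** R' = mat 1" "R' ** ?R = mat 1"
    using det_hyperbolic_frame[OF assms(1)] by (metis invertible_def invertible_det_nz zero_neq_one)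
  have "det R' = 1"
    using R'(1) det_hyperbolic_frame[OF assms(1)] by (metis det_I det_mul mult_1)
  let ?A = "?S ** R'"
  have "star ?A ** ?A = star R' ** (star ?S ** ?S) ** R'"
    by (simp add: star_mult matrix_mul_assoc)
  also have "\<dots> = star R' ** (star ?R ** ?R) ** R'"
    by (simp only: gram_frame assms)
  also have "\<dots> = star (?R ** R') ** (?R ** R')"
    by (simp add: star_mult matrix_mul_assoc)
  finally have "star ?A ** ?A = mat 1"
    by (simp add: R')
  then have "?A \<in> carrier SU"
    using \<open>det R' = 1\<close> by (simp add: mem_SU det_mul det_hyperbolic_frame assms)
  moreover have "?A ** ?R = ?S"
    by (metis R'(2) matrix_mul_assoc matrix_mul_rid)
  then have "?A *v u = x" "?A *v v = y"
    by (simp_all add: matrix_mult_cols cols_eq_iff)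
  ultimately show ?thesis
    by blast
qed

end

locale hyperbolic_pair = even_hermitian_field n q field_type
  for n q :: nat and field_type :: "'a::{field, finite} itself" +
  fixes u v :: "'a ^ 3"
  assumes uv: "hyperbolic u v"
begin

lemma u_nonzero: "u \<noteq> 0"
  using uv by (rule hyperbolic_nonzero)

lemma SU_eqI:
  "A \<in> carrier SU \<Longrightarrow> B \<in> carrier SU \<Longrightarrow> A *v u = B *v u \<Longrightarrow> A *v v = B *v v \<Longrightarrow> A = B"
  using SU_eq_if_eq_on_hyperbolic uv by blast

text \<open>A matrix in \<open>SU\<close> amounts to the image of the pair \<open>(u, v)\<close>,
  and each isotropic \<open>x\<close> has \<open>q^3\<close> partners. The choices of
  \<open>P\<close> used below are all isotropic vectors (group order), the nonzero multiples of
  \<open>u\<close> (\<open>borel\<close>) and \<open>u\<close> alone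
  (\<open>unipotent\<close>).\<close>

lemma card_SU_image_in:
  assumes "P \<subseteq> {x. x \<noteq> 0 \<and> herm x x = 0}"
  shows "card {A \<in> carrier SU. A *v u \<in> P} = card P * q ^ 3"
proof -
  let ?H = "SIGMA x:P. {y. herm y y = 0 \<and> herm x y = 1}"
  have "bij_betw (\<lambda>A. (A *v u, A *v v)) {A \<in> carrier SU. A *v u \<in> P} ?H"
  proof (rule bij_betw_imageI)
    show "inj_on (\<lambda>A. (A *v u, A *v v)) {A \<in> carrier SU. A *v u \<in> P}"
      by (auto intro!: inj_onI SU_eqI)
    show "(\<lambda>A. (A *v u, A *v v)) ` {A \<in> carrier SU. A *v u \<in> P} = ?H"
    proof (intro equalityI subsetI)
      fix p assume "p \<in> ?H"
      then obtain x y where p: "p = (x, y)" "x \<in> P" "hyperbolic x y"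
        using assms by (auto simp: hyperbolic_def)
      then obtain A where "A \<in> carrier SU" "A *v u = x" "A *v v = y"
        using ex_SU_moving_hyperbolic uv by blast
      then show "p \<in> (\<lambda>A. (A *v u, A *v v)) ` {A \<in> carrier SU. A *v u \<in> P}"
        using p by auto
    qed (use hyperbolic_SU[OF _ uv] in \<open>auto simp: hyperbolic_def\<close>)
  qed
  then have "card {A \<in> carrier SU. A *v u \<in> P} = card ?H"
    by (rule bij_betw_same_card)
  also have "\<dots> = (\<Sum>x\<in>P. q ^ 3)"
    using assms by (subst card_SigmaI) (auto intro!: sum.cong card_hyperbolic_partners simp del: sum_constant)
  finally show ?thesis
    by simp
qed

lemma order_SU: "order SU = (q ^ 3 + 1) * (q\<^sup>2 - 1) * q ^ 3"
proof -
  have "{A \<in> carrier SU. A *v u \<in> {x. x \<noteq> 0 \<and> herm x x = 0}} = carrier SU"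
    using hyperbolic_SU[OF _ uv] hyperbolic_nonzero by (auto simp: hyperbolic_def)
  then show ?thesis
    using card_SU_image_in[of "{x. x \<noteq> 0 \<and> herm x x = 0}"] by (simp add: order_def card_isotropic)
qed

lemma star_action:
  assumes "A \<in> carrier SU" "A *v x = c *s x" "x \<noteq> 0"
  shows "c \<noteq> 0" "star A *v x = inverse c *s x"
proof -
  have x: "star A *v (A *v x) = x"
    using assms(1) by (simp add: mem_SU matrix_vector_mul_assoc)
  show "c \<noteq> 0"
    using x assms by auto
  have "inverse c *s (c *s (star A *v x)) = inverse c *s x"
    using x assms(2) by (simp only: vector_scalar_commute)
  then show "star A *v x = inverse c *s x"
    using \<open>c \<noteq> 0\<close> by simp
qed

section \<open>The Borel subgroup as a product of a 2-group and a torus\<close>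

definition borel :: "('a ^ 3 ^ 3) set" where
  "borel = {A \<in> carrier SU. \<exists>c. A *v u = c *s u}"

definition unipotent :: "('a ^ 3 ^ 3) set" where
  "unipotent = {A \<in> carrier SU. A *v u = u}"

text \<open>The eigenvalue on \<open>v\<close> is forced: \<open>herm u v = 1\<close> must be
  preserved.\<close>

definition torus :: "('a ^ 3 ^ 3) set" where
  "torus = {A \<in> carrier SU. \<exists>c. c \<noteq> 0 \<and> A *v u = c *s u \<and> A *v v = inverse (c ^ q) *s v}"

lemma mult_action:
  fixes A B :: "'a ^ 3 ^ 3"
  assumes "A *v x = c *s x" "B *v x = d *s x"
  shows "(A ** B) *v x = (c * d) *s x"
proof -
  have "(A ** B) *v x = A *v (d *s x)"
    using assms(2) by (simp only: matrix_vector_mul_assoc[symmetric])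
  also have "\<dots> = d *s (c *s x)"
    using assms(1) by (simp only: vector_scalar_commute)
  finally show ?thesis
    by (simp add: mult.commute)
qed

lemma v_nonzero: "v \<noteq> 0"
  using uv q_ge_2 by (auto simp: hyperbolic_def herm_3 zero_power)

lemma subgroup_borel: "subgroup borel SU"
proof (rule SU.subgroupI)
  show "borel \<noteq> {}"
    using SU.one_closed by (auto simp: borel_def intro!: exI[of _ "mat 1"] exI[of _ "1 :: 'a"])
  show "inv\<^bsub>SU\<^esub> A \<in> borel" if "A \<in> borel" for A
    using that SU.inv_closed[of A] star_action(2)[of A u] u_nonzero by (auto simp: borel_def inv_SU)
  show "A \<otimes>\<^bsub>SU\<^esub> B \<in> borel" if "A \<in> borel" "B \<in> borel" for A B
    using that SU.m_closed[of A B] mult_action[of A u _ B] by (auto simp: borel_def)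
qed (auto simp: borel_def)

lemma subgroup_unipotent: "subgroup unipotent SU"
proof (rule SU.subgroupI)
  show "unipotent \<noteq> {}"
    using SU.one_closed by (auto simp: unipotent_def)
  show "inv\<^bsub>SU\<^esub> A \<in> unipotent" if "A \<in> unipotent" for A
    using that SU.inv_closed[of A] star_action(2)[of A u 1] u_nonzero
    by (auto simp: unipotent_def inv_SU)
  show "A \<otimes>\<^bsub>SU\<^esub> B \<in> unipotent" if "A \<in> unipotent" "B \<in> unipotent" for A B
    using that SU.m_closed[of A B] mult_action[of A u 1 B 1] by (auto simp: unipotent_def)
qed (auto simp: unipotent_def)

lemma subgroup_torus: "subgroup torus SU"
proof (rule SU.subgroupI)
  show "torus \<noteq> {}"
    using SU.one_closed by (auto simp: torus_def intro!: exI[of _ "mat 1"] exI[of _ "1 :: 'a"])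
  show "inv\<^bsub>SU\<^esub> A \<in> torus" if A: "A \<in> torus" for A
  proof -
    obtain c where c: "A \<in> carrier SU" "c \<noteq> 0" "A *v u = c *s u" "A *v v = inverse (c ^ q) *s v"
      using A by (auto simp: torus_def)
    then have "star A *v u = inverse c *s u" "star A *v v = inverse (inverse c ^ q) *s v"
      using star_action(2)[of A u c] star_action(2)[of A v "inverse (c ^ q)"] u_nonzero v_nonzero
      by (auto simp: power_inverse)
    moreover have "star A \<in> carrier SU"
      using c SU.inv_closed inv_SU by metis
    ultimately show ?thesis
      using c(1,2) by (auto simp: torus_def inv_SU intro!: exI[of _ "inverse c"])
  qed
  show "A \<otimes>\<^bsub>SU\<^esub> B \<in> torus" if AB: "A \<in> torus" "B \<in> torus" for A B
  proof -
    obtain c where c: "A \<in> carrier SU" "c \<noteq> 0" "A *v u = c *s u" "A *v v = inverse (c ^ q) *s v"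
      using AB by (auto simp: torus_def)
    obtain d where d: "B \<in> carrier SU" "d \<noteq> 0" "B *v u = d *s u" "B *v v = inverse (d ^ q) *s v"
      using AB by (auto simp: torus_def)
    have "(A ** B) *v u = (c * d) *s u" "(A ** B) *v v = inverse ((c * d) ^ q) *s v"
      using c d mult_action[of A u c B d] mult_action[of A v "inverse (c ^ q)" B "inverse (d ^ q)"]
      by (simp_all add: power_mult_distrib)
    then show ?thesis
      using c d SU.m_closed[of A B] by (auto simp: torus_def intro!: exI[of _ "c * d"])
  qed
qed (auto simp: torus_def)

lemma inj_scale: "x \<noteq> 0 \<Longrightarrow> inj (\<lambda>c. c *s (x :: 'a ^ 3))"
  by (auto intro!: injI)

lemma card_borel: "card borel = (q\<^sup>2 - 1) * q ^ 3"
proof -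
  let ?P = "(\<lambda>c. c *s u) ` (UNIV - {0})"
  have "borel = {A \<in> carrier SU. A *v u \<in> ?P}"
    using star_action(1)[OF _ _ u_nonzero] by (auto simp: borel_def)
  moreover have "card ?P = q\<^sup>2 - 1"
    using inj_scale[OF u_nonzero] by (simp add: card_image inj_on_subset[of _ UNIV] card_units)
  ultimately show ?thesis
    using uv u_nonzero
    by (simp add: card_SU_image_in image_subset_iff herm_scale_left herm_scale_right hyperbolic_def)
qed

lemma card_unipotent: "card unipotent = q ^ 3"
  using card_SU_image_in[of "{u}"] uv u_nonzero by (simp add: unipotent_def hyperbolic_def)

lemma card_torus: "card torus = q\<^sup>2 - 1"
proof -
  let ?f = "\<lambda>c. (c *s u, inverse (c ^ q) *s v)"
  have "bij_betw (\<lambda>A. (A *v u, A *v v)) torus (?f ` (UNIV - {0}))"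
  proof (rule bij_betw_imageI)
    show "inj_on (\<lambda>A. (A *v u, A *v v)) torus"
      by (auto intro!: inj_onI SU_eqI simp: torus_def)
    show "(\<lambda>A. (A *v u, A *v v)) ` torus = ?f ` (UNIV - {0})"
    proof (intro equalityI subsetI)
      fix p assume "p \<in> ?f ` (UNIV - {0})"
      then obtain c where c: "c \<noteq> 0" "p = ?f c"
        by auto
      then have "hyperbolic (c *s u) (inverse (c ^ q) *s v)"
        using uv by (simp add: hyperbolic_def herm_scale_left herm_scale_right power_inverse)
      then obtain A where "A \<in> carrier SU" "A *v u = c *s u" "A *v v = inverse (c ^ q) *s v"
        using ex_SU_moving_hyperbolic uv by blast
      then show "p \<in> (\<lambda>A. (A *v u, A *v v)) ` torus"
        using c by (auto simp: torus_def intro!: image_eqI[of _ _ A])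
    qed (auto simp: torus_def)
  qed
  then have "card torus = card (?f ` (UNIV - {0}))"
    by (rule bij_betw_same_card)
  also have "\<dots> = q\<^sup>2 - 1"
    using inj_scale[OF u_nonzero] by (subst card_image) (auto simp: inj_on_def card_units)
  finally show ?thesis .
qed

text \<open>The eigenvalue on \<open>u\<close> of a product of a unipotent and a torus element
  determines the torus factor, so the factorisation is unique; comparing orders shows that the
  products fill \<open>borel\<close>.\<close>

lemma mls_set_borel: "mls_set SU borel"
proof -
  have "card unipotent = 2 ^ (n * 3)"
    by (simp only: card_unipotent power_mult q_eq[symmetric])
  then have U: "mls_set SU unipotent"
    using SU.mls_set_prime_power_subgroup[OF subgroup_unipotent two_is_prime_nat] by blast
  have "A ** B = B ** A" if AB: "A \<in> torus" "B \<in> torus" for A B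
  proof (rule SU_eqI)
    obtain c where c: "A \<in> carrier SU" "A *v u = c *s u" "A *v v = inverse (c ^ q) *s v"
      using AB by (auto simp: torus_def)
    obtain d where d: "B \<in> carrier SU" "B *v u = d *s u" "B *v v = inverse (d ^ q) *s v"
      using AB by (auto simp: torus_def)
    show "A ** B \<in> carrier SU" "B ** A \<in> carrier SU"
      using c d SU.m_closed by auto
    show "(A ** B) *v u = (B ** A) *v u" "(A ** B) *v v = (B ** A) *v v"
      using c d mult_action by (metis mult.commute)+
  qed
  then have T: "mls_set SU torus"
    using SU.mls_set_commutative_subgroup[OF subgroup_torus] by simp
  have "inj_on (\<lambda>(s, t). s \<otimes>\<^bsub>SU\<^esub> t) (unipotent \<times> torus)"
  proof (rule inj_onI; clarify)
    fix A S B T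
    assume *: "A \<in> unipotent" "S \<in> torus" "B \<in> unipotent" "T \<in> torus" "A \<otimes>\<^bsub>SU\<^esub> S = B \<otimes>\<^bsub>SU\<^esub> T"
    obtain c where c: "S \<in> carrier SU" "S *v u = c *s u" "S *v v = inverse (c ^ q) *s v"
      using * by (auto simp: torus_def)
    obtain d where d: "T \<in> carrier SU" "T *v u = d *s u" "T *v v = inverse (d ^ q) *s v"
      using * by (auto simp: torus_def)
    have A: "A \<in> carrier SU" "B \<in> carrier SU" "A *v u = 1 *s u" "B *v u = 1 *s u"
      using * by (auto simp: unipotent_def)
    have "(A ** S) *v u = (1 * c) *s u" "(B ** T) *v u = (1 * d) *s u"
      using A c d mult_action by blast+
    then have "c = d"
      using *(5) inj_scale[OF u_nonzero] by (auto dest: injD)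
    then have "S = T"
      using c d by (intro SU_eqI) auto
    then show "A = B \<and> S = T"
      using * A d SU.right_cancel[of T A B] by simp
  qed
  then have UT: "mls_set SU (unipotent <#>\<^bsub>SU\<^esub> torus)"
      "card (unipotent <#>\<^bsub>SU\<^esub> torus) = card unipotent * card torus"
    using SU.mls_set_mult U T by blast+
  have "unipotent <#>\<^bsub>SU\<^esub> torus = borel"
  proof (rule card_subset_eq)
    have "unipotent \<subseteq> borel" "torus \<subseteq> borel"
      by (auto simp: unipotent_def torus_def borel_def intro: exI[of _ 1])
    then show "unipotent <#>\<^bsub>SU\<^esub> torus \<subseteq> borel"
      using subgroup.m_closed[OF subgroup_borel] by (auto simp: set_mult_def)
    show "card (unipotent <#>\<^bsub>SU\<^esub> torus) = card borel"
      by (simp add: UT card_borel card_unipotent card_torus mult.commute)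
  qed simp
  then show ?thesis
    using UT by simp
qed

section \<open>The diagonal subgroup of order \<open>q + 1\<close>\<close>

definition diag_su :: "'a \<Rightarrow> 'a ^ 3 ^ 3" where
  "diag_su a = (\<chi> i j. if i = j then (if i = 1 then a else if i = 2 then 1 else inverse a) else 0)"

lemma diag_su_mult: "diag_su a ** diag_su b = diag_su (a * b)"
  by (simp add: diag_su_def matrix_matrix_mult_def vec_eq_iff forall_3 sum_3)

lemma diag_su_one [simp]: "diag_su 1 = mat 1"
  by (simp add: diag_su_def mat_def vec_eq_iff)

lemma diag_su_in_SU: "a ^ (q + 1) = 1 \<Longrightarrow> diag_su a \<in> carrier SU"
proof -
  assume a: "a ^ (q + 1) = 1"
  then have "a \<noteq> 0" "a ^ q * a = 1"
    by (auto simp: mult.commute)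
  then show ?thesis
    using q_ge_2 by (auto simp: mem_SU det_3 diag_su_def conj_transpose_def matrix_matrix_mult_def vec_eq_iff
      forall_3 sum_3 mat_def power_inverse simp flip: inverse_mult_distrib)
qed

text \<open>Diagonal in the standard basis, which is orthonormal for \<open>herm\<close>, whereas
  \<open>torus\<close> has the isotropic eigenvectors \<open>u\<close> and \<open>v\<close>. Thus
  the coordinate lines fixed here are not isotropic.\<close>

definition diag_subgroup :: "('a ^ 3 ^ 3) set" where
  "diag_subgroup = diag_su ` {a. a ^ (q + 1) = 1}"

lemma subgroup_diag: "subgroup diag_subgroup SU"
proof (rule SU.subgroupI)
  show "diag_subgroup \<subseteq> carrier SU"
    using diag_su_in_SU by (auto simp: diag_subgroup_def)
  show "diag_subgroup \<noteq> {}"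
    by (auto simp: diag_subgroup_def intro: exI[of _ 1])
  show "A \<otimes>\<^bsub>SU\<^esub> B \<in> diag_subgroup" if "A \<in> diag_subgroup" "B \<in> diag_subgroup" for A B
    using that unfolding diag_subgroup_def
    by (auto simp: diag_su_mult power_mult_distrib simp del: power_Suc)
  show "inv\<^bsub>SU\<^esub> A \<in> diag_subgroup" if A: "A \<in> diag_subgroup" for A
  proof -
    obtain a where a: "a ^ (q + 1) = 1" "A = diag_su a"
      using A by (auto simp: diag_subgroup_def)
    then have "a \<noteq> 0" by auto
    then have "inverse a ^ (q + 1) = 1" "diag_su (inverse a) \<otimes>\<^bsub>SU\<^esub> A = \<one>\<^bsub>SU\<^esub>"
      using a by (simp_all only: power_inverse) (simp_all add: diag_su_mult)
    then show ?thesis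
      using a diag_su_in_SU SU.inv_equality
      by (metis (mono_tags, lifting) diag_subgroup_def imageI mem_Collect_eq)
  qed
qed

lemma card_diag_subgroup: "card diag_subgroup = q + 1"
proof -
  have "inj diag_su"
    by (auto intro!: injI simp: diag_su_def vec_eq_iff forall_3)
  then show ?thesis
    using card_norm_fibre[of 1] unfolding diag_subgroup_def
    by (subst card_image) (auto intro: inj_on_subset)
qed

lemma mls_set_diag_subgroup: "mls_set SU diag_subgroup"
proof (rule SU.mls_set_commutative_subgroup[OF subgroup_diag])
  fix A B assume "A \<in> diag_subgroup" "B \<in> diag_subgroup"
  then obtain a b where "A = diag_su a" "B = diag_su b"
    by (auto simp: diag_subgroup_def)
  then show "A \<otimes>\<^bsub>SU\<^esub> B = B \<otimes>\<^bsub>SU\<^esub> A"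
    by (simp add: diag_su_mult mult.commute)
qed simp

lemma diag_su_eq_one_if_fixes_isotropic_line:
  assumes "a ^ (q + 1) = 1" "diag_su a *v x = c *s x" "x \<noteq> 0" "herm x x = 0"
  shows "a = 1"
proof -
  have e: "a * x $ 1 = c * x $ 1" "x $ 2 = c * x $ 2" "inverse a * x $ 3 = c * x $ 3"
    using assms(2) by (auto simp: diag_su_def matrix_vector_mult_def vec_eq_iff forall_3 sum_3)
  have h: "x $ 1 * x $ 1 ^ q + x $ 2 * x $ 2 ^ q = x $ 3 * x $ 3 ^ q"
    using assms(4) by (simp add: herm_3)
  have x: "x $ 1 \<noteq> 0 \<or> x $ 2 \<noteq> 0 \<or> x $ 3 \<noteq> 0"
    using assms(3) by (auto simp: vec_eq_iff forall_3)
  \<comment> \<open>A nonzero isotropic vector has at least two nonzero coordinates, so two of the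
    eigenvalues \<open>a\<close>, 1, \<open>inverse a\<close> coincide. Each coincidence gives
    \<open>a^2 = 1\<close>, hence \<open>a = 1\<close> in characteristic 2.\<close>
  have "x $ 1 \<noteq> 0 \<and> x $ 2 \<noteq> 0 \<or> x $ 1 \<noteq> 0 \<and> x $ 3 \<noteq> 0 \<or> x $ 2 \<noteq> 0 \<and> x $ 3 \<noteq> 0"
    using h x by auto
  then have "a = 1 \<or> a = inverse a \<or> inverse a = 1"
    using e by auto
  moreover have "a \<noteq> 0"
    using assms(1) by auto
  ultimately have "a\<^sup>2 = 1"
    by (metis inverse_eq_1_iff power2_eq_square power_one right_inverse)
  moreover have "a\<^sup>2 + 1 = (a + 1)\<^sup>2"
    by (simp add: power2_sum)
  ultimately show "a = 1"
    by (metis add_eq_0_iff_eq power2_eq_iff_nonneg power_eq_0_iff)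
qed

text \<open>Rephrases membership in a conjugate of \<open>borel\<close> as fixing the isotropic line
  through \<open>g *v u\<close>.\<close>

lemma conj_in_borel:
  assumes "g \<in> carrier SU" "h \<in> carrier SU" "inv\<^bsub>SU\<^esub> g \<otimes>\<^bsub>SU\<^esub> h \<otimes>\<^bsub>SU\<^esub> g \<in> borel"
  shows "\<exists>c. h *v (g *v u) = c *s (g *v u)"
proof -
  obtain c where c: "(star g ** h ** g) *v u = c *s u"
    using assms by (auto simp: borel_def inv_SU)
  have "g ** (star g ** h ** g) = h ** g"
    using assms(1) by (metis matrix_left_right_inverse matrix_mul_assoc matrix_mul_lid mem_SU)
  then have "h *v (g *v u) = g *v ((star g ** h ** g) *v u)"
    by (metis matrix_vector_mul_assoc)
  then show ?thesis
    using c by (auto simp: vector_scalar_commute)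
qed

lemma diag_subgroup_conj_borel:
  assumes "g \<in> carrier SU" "h \<in> diag_subgroup" "inv\<^bsub>SU\<^esub> g \<otimes>\<^bsub>SU\<^esub> h \<otimes>\<^bsub>SU\<^esub> g \<in> borel"
  shows "h = \<one>\<^bsub>SU\<^esub>"
proof -
  obtain a where a: "a ^ (q + 1) = 1" "h = diag_su a"
    using assms(2) by (auto simp: diag_subgroup_def)
  obtain c where "h *v (g *v u) = c *s (g *v u)"
    using conj_in_borel assms a diag_su_in_SU by blast
  moreover have "g *v u \<noteq> 0" "herm (g *v u) (g *v u) = 0"
    using hyperbolic_SU[OF assms(1) uv] hyperbolic_nonzero by (auto simp: hyperbolic_def)
  ultimately have "a = 1"
    using diag_su_eq_one_if_fixes_isotropic_line a by metis
  then show ?thesis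
    by (simp add: a(2))
qed

section \<open>The centre and the passage to the quotient\<close>

lemma group_center_SU:
  assumes "coprime 3 (q + 1)"
  shows "group_center SU = {\<one>\<^bsub>SU\<^esub>}"
proof
  show "{\<one>\<^bsub>SU\<^esub>} \<subseteq> group_center SU"
    using SU.one_closed by (auto simp: group_center_def)
  show "group_center SU \<subseteq> {\<one>\<^bsub>SU\<^esub>}"
  proof
    fix Z assume "Z \<in> group_center SU"
    then have Z: "Z \<in> carrier SU" and comm: "\<And>A. A \<in> carrier SU \<Longrightarrow> Z ** A = A ** Z"
      by (auto simp: group_center_def)
    \<comment> \<open>There are \<open>q + 1 >= 3\<close> elements of norm 1, so some
      \<open>a\<close> differs from 1. Then \<open>a\<close>, 1, \<open>inverse a\<close> are
      distinct, and commuting with \<open>diag_su a\<close> kills the off-diagonal entries of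
      \<open>Z\<close>.\<close>
    have "card {a :: 'a. a ^ (q + 1) = 1} > card {1 :: 'a}"
      using card_norm_fibre[of 1] q_ge_2 by simp
    then have "\<not> {a :: 'a. a ^ (q + 1) = 1} \<subseteq> {1}"
      by (metis card_mono finite.emptyI finite_insert not_less)
    then obtain a :: 'a where a: "a ^ (q + 1) = 1" "a \<noteq> 1"
      by auto
    then have "a \<noteq> 0"
      by auto
    have "a \<noteq> inverse a"
    proof
      assume "a = inverse a"
      then have "(a + 1)\<^sup>2 = 0"
        using \<open>a \<noteq> 0\<close> by (simp add: power2_sum) (simp add: power2_eq_square field_simps)
      then show False
        using a by simp
    qed
    have "Z ** diag_su a = diag_su a ** Z"
      using a comm diag_su_in_SU by blast
    then have off: "Z $ 1 $ 2 = 0" "Z $ 1 $ 3 = 0" "Z $ 2 $ 1 = 0" "Z $ 2 $ 3 = 0"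
        "Z $ 3 $ 1 = 0" "Z $ 3 $ 2 = 0"
      using a \<open>a \<noteq> inverse a\<close> 
      by (auto simp: diag_su_def matrix_matrix_mult_def vec_eq_iff forall_3 sum_3 inverse_eq_1_iff)
    \<comment> \<open>A cyclic permutation matrix; commuting with it makes the diagonal entries of
      \<open>Z\<close> equal.\<close>
    define C :: "'a ^ 3 ^ 3" where
      "C = (\<chi> i j. if i = 1 \<and> j = 2 \<or> i = 2 \<and> j = 3 \<or> i = 3 \<and> j = 1 then 1 else 0)"
    have "C \<in> carrier SU"
      using q_ge_2 by (simp add: mem_SU C_def det_3 conj_transpose_def matrix_matrix_mult_def vec_eq_iff
        forall_3 sum_3 mat_def)
    then have "Z ** C = C ** Z"
      by (rule comm)
    then have "(Z ** C) $ 1 $ 2 = (C ** Z) $ 1 $ 2" "(Z ** C) $ 2 $ 3 = (C ** Z) $ 2 $ 3"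
      by simp_all
    then have eq: "Z $ 1 $ 1 = Z $ 2 $ 2" "Z $ 2 $ 2 = Z $ 3 $ 3"
      by (simp_all add: C_def matrix_matrix_mult_def sum_3)
    let ?z = "Z $ 3 $ 3"
    \<comment> \<open>The determinant makes the scalar a cube root of unity, unitarity a root of
      order dividing \<open>q + 1\<close>; coprimality leaves only 1.\<close>
    have "?z ^ 3 = 1"
      using Z by (simp add: mem_SU det_3 off eq power3_eq_cube)
    moreover have "?z ^ (q + 1) = 1"
    proof -
      have "(star Z ** Z) $ 3 $ 3 = 1"
        using Z by (simp add: mem_SU mat_def)
      then show ?thesis
        using q_ge_2 by (simp add: conj_transpose_def matrix_matrix_mult_def sum_3 off mult.commute)
    qed
    ultimately have "?z = 1"
      using assms by (rule power_coprime_eq_one) simp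
    then have "Z = mat 1"
      by (simp add: mat_def vec_eq_iff forall_3 off eq)
    then show "Z \<in> {\<one>\<^bsub>SU\<^esub>}"
      by simp
  qed
qed

lemma has_MLS_PSU3:
  assumes "coprime 3 (q + 1)" "mls_set SU (carrier SU)"
  shows "has_MLS (PSU3 q :: ('a ^ 3 ^ 3) set monoid)"
proof -
  have "normal {\<one>\<^bsub>SU\<^esub>} SU"
    by (rule SU.one_is_normal)
  then have grp: "group (SU Mod {\<one>\<^bsub>SU\<^esub>})"
    by (rule normal.factorgroup_is_group)
  have "the_elem \<in> iso (SU Mod {\<one>\<^bsub>SU\<^esub>}) SU"
    by (rule SU.trivial_factor_iso)
  then have "inv_into (carrier (SU Mod {\<one>\<^bsub>SU\<^esub>})) the_elem \<in> iso SU (SU Mod {\<one>\<^bsub>SU\<^esub>})"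
    using group.iso_set_sym grp by blast
  then have "mls_set (SU Mod {\<one>\<^bsub>SU\<^esub>}) (carrier (SU Mod {\<one>\<^bsub>SU\<^esub>}))"
    using mls_set_iso assms(2) group_SU grp by blast
  then show ?thesis
    unfolding PSU3_def group_center_SU[OF assms(1)] by (rule mls_set_imp_has_MLS)
qed

lemma mls_set_SU_by_double_cosets:
  assumes "subgroup H SU" "mls_set SU H" "prime p" "card H * p = q ^ 3 + 1"
    and "\<And>g h. g \<in> carrier SU \<Longrightarrow> h \<in> H \<Longrightarrow> inv\<^bsub>SU\<^esub> g \<otimes>\<^bsub>SU\<^esub> h \<otimes>\<^bsub>SU\<^esub> g \<in> borel \<Longrightarrow> h = \<one>\<^bsub>SU\<^esub>"
  shows "mls_set SU (carrier SU)"
proof (rule SU.mls_set_double_cosets[OF finite_SU assms(1) subgroup_borel assms(2) mls_set_borel])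
  show "order SU = card H * p * card borel"
    unfolding assms(4) by (simp only: order_SU card_borel mult.assoc)
qed (use assms in blast)+

end

section \<open>A subgroup of order \<open>q\<^sup>2 - q + 1\<close>\<close>

text \<open>\<open>f\<close> generates an action of the cyclic group of prime order \<open>r\<close>
  on \<open>X\<close>, so the points that are not fixed fall into orbits of size exactly
  \<open>r\<close>.\<close>

lemma prime_dvd_card_not_fixed:
  fixes f :: "'b \<Rightarrow> 'b"
  assumes "finite X" "f ` X \<subseteq> X" "\<And>x. x \<in> X \<Longrightarrow> (f ^^ r) x = x" "prime r"
  shows "r dvd card {x \<in> X. f x \<noteq> x}"
proof -
  let ?Y = "{x \<in> X. f x \<noteq> x}"
  have "r > 0"
    using assms(4) by (simp add: prime_gt_0_nat)
  have inX: "(f ^^ i) x \<in> X" if "x \<in> X" for i x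
    using that assms(2) by (induction i) auto
  define orb where "orb x = range (\<lambda>i. (f ^^ i) x)" for x
  have orb_lessThan: "orb x = (\<lambda>i. (f ^^ i) x) ` {..<r}" if "x \<in> X" for x
  proof -
    have "(f ^^ i) x = (f ^^ (i mod r)) x" for i
      using assms(3)[OF that] by (simp add: funpow_mod_eq)
    moreover have "i mod r \<in> {..<r}" for i
      using \<open>r > 0\<close> by simp
    ultimately show ?thesis
      unfolding orb_def by blast
  qed
  \<comment> \<open>By Bezout some multiple of \<open>d\<close> is 1 modulo \<open>r\<close>, so a
    point with a period \<open>d < r\<close> is already fixed by \<open>f\<close>.\<close>
  have fixed_if: "f x = x" if "x \<in> X" "(f ^^ d) x = x" "0 < d" "d < r" for d x
  proof -
    have "coprime d r"
      using that(3,4) assms(4) by (metis coprime_commute nat_dvd_not_less prime_imp_coprime_nat)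
    then obtain s t where st: "d * s = r * t + 1"
      using bezout_nat[of d r] \<open>0 < d\<close> by (auto simp: coprime_iff_gcd_eq_1)
    have pow: "(f ^^ (k * j)) x = x" if "(f ^^ k) x = x" for k j
      using that by (induction j) (auto simp: funpow_add)
    have "(f ^^ (d * s)) x = x"
      using pow that(2) by blast
    moreover have "(f ^^ (r * t + 1)) x = f x"
      using pow[OF assms(3)[OF that(1)]] by (simp add: funpow_swap1)
    ultimately show ?thesis
      using st by simp
  qed
  have orb_eq: "orb y = orb x" if "x \<in> X" "y \<in> orb x" for x y
  proof -
    obtain i where i: "i < r" "y = (f ^^ i) x"
      using \<open>x \<in> X\<close> \<open>y \<in> orb x\<close> orb_lessThan by blast
    have "(f ^^ (r - i)) y = x"
      using i assms(3)[OF that(1)] by (simp add: funpow_add[symmetric, unfolded o_def, THEN fun_cong])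
    then have "(f ^^ j) x = (f ^^ (j + (r - i))) y" for j
      by (simp add: funpow_add)
    moreover have "(f ^^ j) y = (f ^^ (j + i)) x" for j
      using i by (simp add: funpow_add)
    ultimately show ?thesis
      unfolding orb_def by blast
  qed
  have orb_Y: "orb x \<subseteq> ?Y" if "x \<in> ?Y" for x
  proof
    fix y assume "y \<in> orb x"
    then have "x \<in> orb y"
      using orb_eq[of x y] that by (auto simp: orb_def intro!: range_eqI[of _ _ 0])
    then obtain j where "x = (f ^^ j) y"
      by (auto simp: orb_def)
    moreover have "y \<in> X"
      using \<open>y \<in> orb x\<close> inX that by (auto simp: orb_def)
    moreover have "(f ^^ j) y = y" if "f y = y"
      using that by (induction j) auto
    ultimately show "y \<in> ?Y"
      using that by auto
  qed
  have card_orb: "card (orb x) = r" if "x \<in> ?Y" for x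
  proof -
    have "False" if ij: "i < j" "j < r" "(f ^^ i) x = (f ^^ j) x" for i j
    proof -
      have "(f ^^ (r - i)) ((f ^^ i) x) = (f ^^ (r - i)) ((f ^^ j) x)"
        using ij by simp
      then have "(f ^^ (r - i + i)) x = (f ^^ (r - i + j)) x"
        by (simp only: funpow_add o_apply)
      moreover have "r - i + i = r" "r - i + j = j - i + r"
        using ij by auto
      ultimately have "(f ^^ r) x = (f ^^ (j - i + r)) x"
        by simp
      then have "x = (f ^^ (j - i)) x"
        using assms(3)[of x] \<open>x \<in> ?Y\<close> by (simp only: funpow_add o_apply mem_Collect_eq)
      moreover have "0 < j - i" "j - i < r"
        using ij by auto
      ultimately have "f x = x"
        using fixed_if \<open>x \<in> ?Y\<close> by (metis (no_types, lifting) mem_Collect_eq)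
      then show False
        using \<open>x \<in> ?Y\<close> by simp
    qed
    then have "inj_on (\<lambda>i. (f ^^ i) x) {..<r}"
      by (intro inj_onI) (metis lessThan_iff linorder_neqE_nat)
    then show ?thesis
      using orb_lessThan[of x] that by (simp add: card_image)
  qed
  have Union: "\<Union> (orb ` ?Y) = ?Y"
  proof
    show "\<Union> (orb ` ?Y) \<subseteq> ?Y"
      by (rule UN_least) (rule orb_Y)
    have "x \<in> orb x" for x
      unfolding orb_def by (rule range_eqI[of _ _ 0]) simp
    then show "?Y \<subseteq> \<Union> (orb ` ?Y)"
      by blast
  qed
  have "r * card (orb ` ?Y) = card (\<Union> (orb ` ?Y))"
  proof (rule card_partition)
    show "finite (orb ` ?Y)" "finite (\<Union> (orb ` ?Y))"
      unfolding Union using assms(1) by simp_all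
    show "card c = r" if "c \<in> orb ` ?Y" for c
      using that card_orb by blast
    show "c \<inter> c' = {}" if cc': "c \<in> orb ` ?Y" "c' \<in> orb ` ?Y" "c \<noteq> c'" for c c'
    proof (rule ccontr)
      assume "c \<inter> c' \<noteq> {}"
      then obtain z where "z \<in> c" "z \<in> c'"
        by blast
      moreover obtain x x' where "x \<in> X" "x' \<in> X" "c = orb x" "c' = orb x'"
        using cc'(1,2) by blast
      ultimately show False
        using orb_eq[of x z] orb_eq[of x' z] cc'(3) by simp
    qed
  qed
  then have "card ?Y = r * card (orb ` ?Y)"
    unfolding Union by (rule sym)
  then show ?thesis
    by (rule dvdI)
qed

section \<open>Subspaces and scalar matrices over a finite field\<close>

lemma card_span_independent:
  fixes B :: "('a::{field, finite} ^ 'n) set"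
  assumes "vec.independent B"
  shows "card (vec.span B) = CARD('a) ^ card B"
  using finite[of B] assms
proof (induction B rule: finite_induct)
  case empty
  then show ?case
    by simp
next
  case (insert b B)
  then have b: "b \<notin> vec.span B" and "vec.independent B"
    by (auto simp: vec.independent_insert)
  let ?f = "\<lambda>(k :: 'a, x). k *s b + x"
  have "bij_betw ?f (UNIV \<times> vec.span B) (vec.span (insert b B))"
  proof (rule bij_betw_imageI)
    show "inj_on ?f (UNIV \<times> vec.span B)"
    proof (rule inj_onI; clarify)
      fix k x k' x' assume x: "x \<in> vec.span B" "x' \<in> vec.span B" and eq: "k *s b + x = k' *s b + x'"
      have "k = k'"
      proof (rule ccontr)
        assume "k \<noteq> k'"
        have "(k - k') *s b = x' - x"
          using eq by (simp add: vector_sub_rdistrib algebra_simps)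
        then have "(k - k') *s b \<in> vec.span B"
          using x by (simp add: vec.span_diff)
        then have "inverse (k - k') *s ((k - k') *s b) \<in> vec.span B"
          by (rule vec.span_scale)
        then show False
          using b \<open>k \<noteq> k'\<close> by simp
      qed
      then show "k = k' \<and> x = x'"
        using eq by simp
    qed
    show "?f ` (UNIV \<times> vec.span B) = vec.span (insert b B)"
    proof (intro equalityI subsetI)
      fix y assume "y \<in> vec.span (insert b B)"
      then obtain k where "y - k *s b \<in> vec.span B"
        by (auto simp: vec.span_insert)
      then show "y \<in> ?f ` (UNIV \<times> vec.span B)"
        by (intro image_eqI[of _ _ "(k, y - k *s b)"]) auto
    next
      fix y assume "y \<in> ?f ` (UNIV \<times> vec.span B)"
      then obtain k x where "x \<in> vec.span B" "y = k *s b + x"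
        by auto
      then show "y \<in> vec.span (insert b B)"
        by (auto simp: vec.span_insert intro!: exI[of _ k])
    qed
  qed
  then have "card (vec.span (insert b B)) = card ((UNIV :: 'a set) \<times> vec.span B)"
    by (metis bij_betw_same_card)
  then show ?case
    using insert \<open>vec.independent B\<close> by (simp add: card_cartesian_product)
qed

lemma card_subspace:
  fixes W :: "('a::{field, finite} ^ 'n) set"
  assumes "vec.subspace W"
  shows "\<exists>k \<le> CARD('n). card W = CARD('a) ^ k"
proof -
  obtain B where B: "B \<subseteq> W" "vec.independent B" "W \<subseteq> vec.span B"
    by (rule vec.maximal_independent_subset)
  have "vec.span B = W"
    using B assms by (simp add: subset_antisym vec.span_minimal)
  then have W: "card W = CARD('a) ^ card B"
    using card_span_independent B(2) by metis
  have "card W \<le> CARD('a) ^ CARD('n)"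
    using card_mono[of UNIV W] by simp
  moreover have "CARD('a) > 1"
    using card_mono[of UNIV "{0, 1 :: 'a}"] by simp
  ultimately show ?thesis
    using W by (intro exI[of _ "card B"]) simp
qed

lemma matrix_add_rdistrib: "(B + C) ** A = B ** A + C ** (A :: 'a::semiring_1 ^ 'n ^ 'm)"
  by (simp add: matrix_matrix_mult_def vec_eq_iff sum.distrib algebra_simps)

lemma mat_add: "mat (a + b) = (mat a + mat b :: 'a::semiring_1 ^ 'n ^ 'n)"
  by (simp add: mat_def vec_eq_iff)

lemma matrix_commute_mult:
  fixes A B Y :: "'a::semiring_1 ^ 'n ^ 'n"
  assumes "Y ** A = A ** Y" "Y ** B = B ** Y"
  shows "Y ** (A ** B) = (A ** B) ** Y"
proof -
  have "Y ** (A ** B) = (A ** Y) ** B"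
    by (simp only: matrix_mul_assoc assms(1))
  also have "\<dots> = A ** (B ** Y)"
    by (simp only: matrix_mul_assoc[symmetric] assms(2))
  finally show ?thesis
    by (simp only: matrix_mul_assoc)
qed

lemma mat_1_neq_0 [simp]: "mat 1 \<noteq> (0 :: 'a::semiring_1 ^ 'n ^ 'n)"
  by (simp add: mat_def vec_eq_iff)

lemma mat_mult_left: "mat a ** A = (\<chi> i j. a * A $ i $ j)"
  and mat_mult_right: "A ** mat a = (\<chi> i j. A $ i $ j * a)" for A :: "'a::semiring_1 ^ 'n ^ 'n"
  unfolding matrix_matrix_mult_def mat_def
  by (auto simp only: vec_eq_iff vec_lambda_beta if_distrib if_distribR sum.delta'[OF finite]
      sum.delta[OF finite] mult_zero_left mult_zero_right if_True UNIV_I)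

lemma mat_mult_mat: "mat a ** mat b = (mat (a * b) :: 'a::semiring_1 ^ 'n ^ 'n)"
  unfolding mat_mult_left by (simp add: mat_def vec_eq_iff)

lemma mat_mult_commute: "mat a ** A = A ** mat a" for A :: "'a::comm_semiring_1 ^ 'n ^ 'n"
  unfolding mat_mult_left mat_mult_right by (simp add: mult.commute)

lemma mat_mult_vector: "mat a *v x = a *s (x :: 'a::semiring_1 ^ 'n)"
  unfolding matrix_vector_mult_def mat_def vector_scalar_mult_def
  by (auto simp only: vec_eq_iff vec_lambda_beta if_distrib if_distribR sum.delta'[OF finite]
      sum.delta[OF finite] mult_zero_left if_True UNIV_I)

lemma subspace_kernel:
  fixes A :: "'a::field ^ 'n ^ 'n"
  shows "vec.subspace {x. A *v x = 0}"
  by (simp add: vec.subspace_def matrix_vector_right_distrib vector_scalar_commute)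

section \<open>Arithmetic of \<open>q^2 - q + 1\<close>\<close>

lemma singer_factor: "(q\<^sup>2 - q + 1) * (q + 1) = q ^ 3 + (1 :: nat)"
proof (cases q)
  case (Suc k)
  then show ?thesis
    by (simp add: power2_eq_square power3_eq_cube algebra_simps)
qed simp

text \<open>If \<open>r\<close> divided \<open>q\<close>, \<open>q - 1\<close>, \<open>q + 1\<close>
  or \<open>q^2 + 1\<close>, reducing \<open>q^2 - q + 1\<close> by it would make \<open>r\<close>
  divide 1, 1, 3 or \<open>q\<close>; the third is excluded by coprimality with 3. The computation
  is done in the integers, where subtraction is not truncated.\<close>

lemma prime_dvd_singer:
  fixes q r :: nat
  assumes "prime r" "r dvd q\<^sup>2 - q + 1" "coprime 3 (q + 1)" "q > 0"
  shows "\<not> r dvd q" "\<not> r dvd q\<^sup>2 - 1" "\<not> r dvd q ^ 4 - 1"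
proof -
  have m: "int r dvd (int q)\<^sup>2 - int q + 1"
  proof -
    have "int (q\<^sup>2 - q + 1) = (int q)\<^sup>2 - int q + 1"
      using assms(4) by (simp add: of_nat_diff power2_eq_square)
    then show ?thesis
      using assms(2) by (metis int_dvd_int_iff)
  qed
  have r: "prime (int r)"
    using assms(1) by simp
  then have not1: "\<not> int r dvd 1"
    by (meson not_prime_unit)
  have q: "\<not> int r dvd int q"
  proof
    assume "int r dvd int q"
    then have "int r dvd ((int q)\<^sup>2 - int q + 1) - int q * (int q - 1)"
      using m by (intro dvd_diff) auto
    then show False
      using not1 by (simp add: algebra_simps power2_eq_square)
  qed
  then show "\<not> r dvd q"
    by simp
  have m1: "\<not> int r dvd int q - 1"
  proof
    assume "int r dvd int q - 1"
    then have "int r dvd ((int q)\<^sup>2 - int q + 1) - int q * (int q - 1)"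
      using m by (intro dvd_diff) auto
    then show False
      using not1 by (simp add: algebra_simps power2_eq_square)
  qed
  have p1: "\<not> int r dvd int q + 1"
  proof
    assume *: "int r dvd int q + 1"
    then have "int r dvd ((int q)\<^sup>2 - int q + 1) - (int q - 2) * (int q + 1)"
      using m by (intro dvd_diff) auto
    then have "int r dvd 3"
      by (simp add: algebra_simps power2_eq_square)
    then have "r dvd 3"
      by (metis int_dvd_int_iff of_nat_numeral)
    moreover have "int r dvd int (q + 1)"
      using * by (simp add: add.commute)
    then have "r dvd q + 1"
      by (simp only: int_dvd_int_iff)
    ultimately have "r dvd 1"
      using assms(3) coprime_common_divisor by blast
    then show False
      using assms(1) by simp
  qed
  have pp: "\<not> int r dvd (int q)\<^sup>2 + 1"
  proof
    assume "int r dvd (int q)\<^sup>2 + 1"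
    then have "int r dvd ((int q)\<^sup>2 + 1) - ((int q)\<^sup>2 - int q + 1)"
      using m by (intro dvd_diff)
    then show False
      using q by simp
  qed
  have s: "\<not> int r dvd (int q)\<^sup>2 - 1"
  proof -
    have "(int q)\<^sup>2 - 1 = (int q - 1) * (int q + 1)"
      by (simp add: algebra_simps power2_eq_square)
    then show ?thesis
      using m1 p1 r by (simp add: prime_dvd_mult_iff)
  qed
  have f: "\<not> int r dvd (int q) ^ 4 - 1"
  proof -
    have "(int q) ^ 4 - 1 = ((int q)\<^sup>2 - 1) * ((int q)\<^sup>2 + 1)"
      by (simp add: algebra_simps power2_eq_square power4_eq_xxxx)
    then show ?thesis
      using s pp r by (simp add: prime_dvd_mult_iff)
  qed
  have "int (q\<^sup>2 - 1) = (int q)\<^sup>2 - 1" "int (q ^ 4 - 1) = (int q) ^ 4 - 1"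
    using assms(4) by (simp_all add: of_nat_diff)
  then show "\<not> r dvd q\<^sup>2 - 1" "\<not> r dvd q ^ 4 - 1"
    using s f by (metis int_dvd_int_iff)+
qed

text \<open>The second number is the order of \<open>borel\<close>.\<close>

lemma coprime_singer:
  fixes q :: nat
  assumes "coprime 3 (q + 1)" "q > 0"
  shows "coprime (q\<^sup>2 - q + 1) ((q\<^sup>2 - 1) * q ^ 3)"
proof (rule ccontr)
  assume "\<not> ?thesis"
  then obtain r where "prime r" "r dvd q\<^sup>2 - q + 1" "r dvd (q\<^sup>2 - 1) * q ^ 3"
    using prime_factor_nat[of "gcd (q\<^sup>2 - q + 1) ((q\<^sup>2 - 1) * q ^ 3)"]
    by (auto simp: coprime_iff_gcd_eq_1 simp del: power_Suc)
  then show False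
    using prime_dvd_singer[of r q] assms by (auto simp: prime_dvd_mult_iff dest: prime_dvd_power)
qed

text \<open>
  An element \<open>M\<close> of prime order \<open>r\<close> dividing \<open>q\<^sup>2 - q + 1\<close> acts irreducibly, so its centraliser in the
  matrix ring is a field with \<open>q\<^sup>6\<close> elements. On this field the conjugate transpose is
  \<open>Y \<mapsto> Y\<^bsup>q^3\<^esup>\<close>, because both maps are ring homomorphisms that agree on scalars and on \<open>M\<close>. Hence
  elements of order dividing \<open>q\<^sup>2 - q + 1\<close> are unitary.
\<close>

locale singer_element = even_hermitian_field n q field_type
  for n q :: nat and field_type :: "'a::{field, finite} itself" +
  fixes M :: "'a ^ 3 ^ 3" and r :: nat
  assumes coprime3: "coprime 3 (q + 1)"
    and M: "M \<in> carrier SU" "M \<noteq> mat 1" "M [^]\<^bsub>SU\<^esub> r = mat 1"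
    and r: "prime r" "r dvd q\<^sup>2 - q + 1"
begin

lemma funpow_M: "(((*v) M) ^^ k) x = (M [^]\<^bsub>SU\<^esub> k) *v x"
proof (induction k arbitrary: x)
  case (Suc k)
  have "((*v) M ^^ Suc k) x = ((*v) M ^^ k) (M *v x)"
    by (simp add: funpow_swap1)
  then show ?case
    by (simp add: Suc matrix_vector_mul_assoc)
qed simp

lemma prime_dvd_card_not_fixed_M:
  assumes "\<And>x. x \<in> W \<Longrightarrow> M *v x \<in> W"
  shows "r dvd card {x \<in> W. M *v x \<noteq> x}"
  using assms r(1) by (intro prime_dvd_card_not_fixed) (auto simp: funpow_M M(3))

lemma card_subspace_cases:
  assumes "vec.subspace (W :: ('a ^ 3) set)"
  shows "card W = 1 \<or> card W = q\<^sup>2 \<or> card W = q ^ 4 \<or> card W = q ^ 6"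
proof -
  obtain k where "k \<le> 3" "card W = (q\<^sup>2) ^ k"
    using card_subspace[OF assms] by (auto simp: card_field)
  moreover have "k = 0 \<or> k = 1 \<or> k = 2 \<or> k = 3"
    using \<open>k \<le> 3\<close> by auto
  ultimately show ?thesis
    by (auto simp flip: power_mult)
qed

lemma card_vec3: "card (UNIV :: ('a ^ 3) set) = q ^ 6"
  by (simp add: card_field flip: power_mult)

lemma eq_UNIV_if_card:
  assumes "card (W :: ('a ^ 3) set) = q ^ 6"
  shows "W = UNIV"
  using assms by (intro card_subset_eq) (auto simp del: CARD_vec simp: card_vec3)

lemma q_pos: "q > 0"
  using q_ge_2 by simp

lemmas not_dvd = prime_dvd_singer[OF r coprime3 q_pos]

text \<open>\<open>r\<close> divides the number \<open>q^6 - card ?F\<close> of moved vectors. This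
  rules out fixed spaces of dimension 1 and 2, and dimension 3 would mean
  \<open>M = mat 1\<close>.\<close>

lemma M_fixes_only_0:
  assumes "M *v x = x"
  shows "x = 0"
proof -
  let ?F = "{x. M *v x = x}"
  have sub: "vec.subspace ?F"
    by (simp add: vec.subspace_def matrix_vector_right_distrib vector_scalar_commute)
  have "r dvd card {x \<in> UNIV. M *v x \<noteq> x}"
    by (rule prime_dvd_card_not_fixed_M) simp
  moreover have "{x \<in> UNIV. M *v x \<noteq> x} = UNIV - ?F"
    by auto
  ultimately have dvd: "r dvd q ^ 6 - card ?F"
    by (simp add: card_Diff_subset card_vec3 del: CARD_vec)
  have "q ^ 6 - q\<^sup>2 = q\<^sup>2 * (q ^ 4 - 1)" "q ^ 6 - q ^ 4 = q ^ 4 * (q\<^sup>2 - 1)"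
    by (simp_all add: diff_mult_distrib2 flip: power_add)
  then have "\<not> r dvd q ^ 6 - q\<^sup>2" "\<not> r dvd q ^ 6 - q ^ 4"
    using not_dvd r(1) by (auto simp: prime_dvd_mult_iff dest: prime_dvd_power)
  \<comment> \<open>modulo \<open>r\<close>, the number \<open>q\<close> has order 6\<close>
  then have "card ?F = 1 \<or> card ?F = q ^ 6"
    using card_subspace_cases[OF sub] dvd by auto
  moreover have "card ?F \<noteq> q ^ 6"
  proof
    assume "card ?F = q ^ 6"
    then have "M *v x = mat 1 *v x" for x
      using eq_UNIV_if_card[of ?F] by auto
    then have "M = mat 1"
      by (simp add: matrix_eq)
    then show False
      using M(2) by simp
  qed
  ultimately obtain z where z: "?F = {z}"
    by (auto simp: card_1_singleton_iff)
  have "0 \<in> ?F" "x \<in> ?F"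
    using assms by simp_all
  then show ?thesis
    unfolding z by simp
qed

text \<open>All nonzero vectors of \<open>W\<close> are moved, so \<open>r\<close> divides
  \<open>card W - 1\<close>, which excludes \<open>q^2\<close> and \<open>q^4\<close>
  elements.\<close>

lemma invariant_subspace:
  assumes "vec.subspace W" "\<And>x. x \<in> W \<Longrightarrow> M *v x \<in> W"
  shows "W = {0} \<or> W = UNIV"
proof -
  have "0 \<in> W"
    using assms(1) by (rule vec.subspace_0)
  have "r dvd card {x \<in> W. M *v x \<noteq> x}"
    using assms(2) by (rule prime_dvd_card_not_fixed_M)
  moreover have "{x \<in> W. M *v x \<noteq> x} = W - {0}"
    using M_fixes_only_0 by auto
  ultimately have "r dvd card W - 1"
    using \<open>0 \<in> W\<close> by (simp add: card_Diff_singleton)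
  then have "card W = 1 \<or> card W = q ^ 6"
    using card_subspace_cases[OF assms(1)] not_dvd by auto
  then show ?thesis
    using eq_UNIV_if_card \<open>0 \<in> W\<close> by (metis card_1_singletonE singletonD)
qed

section \<open>The centraliser of \<open>M\<close> as a field with \<open>q^6\<close>
  elements\<close>

definition cent :: "('a ^ 3 ^ 3) set" where
  "cent = {Y. Y ** M = M ** Y}"

lemma cent_closed:
  assumes "Y \<in> cent" "Z \<in> cent"
  shows "Y + Z \<in> cent" "Y ** Z \<in> cent"
proof -
  show "Y + Z \<in> cent"
    using assms by (simp add: cent_def matrix_add_ldistrib matrix_add_rdistrib)
  have "M ** (Y ** Z) = (Y ** Z) ** M"
    using assms by (intro matrix_commute_mult) (simp_all add: cent_def)
  then show "Y ** Z \<in> cent"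
    by (simp add: cent_def)
qed

lemma mat_in_cent: "mat a \<in> cent"
  by (simp add: cent_def mat_mult_commute)

lemma M_in_cent: "M \<in> cent"
  by (simp add: cent_def)

text \<open>Schur's lemma: the kernel of \<open>Y\<close> is invariant under \<open>M\<close>, hence
  zero or everything.\<close>

lemma cent_kernel:
  assumes "Y \<in> cent" "Y *v x = 0" "x \<noteq> 0"
  shows "Y = 0"
proof -
  let ?K = "{x. Y *v x = 0}"
  have "M *v x \<in> ?K" if "x \<in> ?K" for x
    using that assms(1) by (simp add: cent_def matrix_vector_mul_assoc)
      (metis matrix_vector_mul_assoc matrix_vector_mult_0_right)
  then have "?K = {0} \<or> ?K = UNIV"
    by (intro invariant_subspace subspace_kernel)
  then have "?K = UNIV"
    using assms by auto
  then have "Y *v x = 0 *v x" for x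
    by auto
  then show ?thesis
    by (simp add: matrix_eq)
qed

lemma cent_inverse:
  assumes "Y \<in> cent" "Y \<noteq> 0"
  shows "\<exists>Z \<in> cent. Z \<noteq> 0 \<and> Z ** Y = mat 1"
proof -
  obtain Z where Z: "Z ** Y = mat 1"
    using cent_kernel[OF assms(1)] assms(2) matrix_left_invertible_ker[of Y] by blast
  then have Z': "Y ** Z = mat 1"
    by (simp add: matrix_left_right_inverse)
  have "Z ** M = Z ** (M ** Y) ** Z"
    using Z' by (metis matrix_mul_assoc matrix_mul_rid)
  also have "\<dots> = Z ** (Y ** M) ** Z"
    using assms(1) by (simp add: cent_def)
  also have "\<dots> = M ** Z"
    using Z by (metis matrix_mul_assoc matrix_mul_lid)
  finally have "Z \<in> cent"
    by (simp add: cent_def)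
  moreover have "Z \<noteq> 0"
    using Z by auto
  ultimately show ?thesis
    using Z by blast
qed

text \<open>Polynomials of degree at most 2 in \<open>M\<close>, indexed by coefficient triples so
  that they can be counted.\<close>

definition quad :: "'a \<times> 'a \<times> 'a \<Rightarrow> 'a ^ 3 ^ 3" where
  "quad = (\<lambda>(a, b, c). mat a + mat b ** M + mat c ** (M ** M))"

lemma quad_in_cent: "quad p \<in> cent"
  by (cases p) (simp add: quad_def cent_closed mat_in_cent M_in_cent)

lemma quad_vector: "quad (a, b, c) *v x = a *s x + b *s (M *v x) + c *s (M *v (M *v x))"
  by (simp only: quad_def prod.case matrix_vector_mult_add_rdistrib mat_mult_vector
      matrix_vector_mul_assoc[symmetric])

lemma no_small_invariant:
  fixes f :: "'a \<times> 'a \<Rightarrow> 'a ^ 3"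
  assumes "vec.subspace (range f)" "\<And>p. M *v f p \<in> range f" "x \<in> range f"
  shows "x = 0"
proof -
  have "card (range f) \<le> card (UNIV :: ('a \<times> 'a) set)"
    by (rule card_image_le) simp
  also have "\<dots> = q ^ 4"
    by (simp add: card_cartesian_product[of UNIV UNIV, simplified] card_field flip: power_add)
  also have "\<dots> < q ^ 6"
    using q_ge_2 by (intro power_strict_increasing) auto
  finally have "range f \<noteq> UNIV"
    using card_vec3 by auto
  then have "range f = {0}"
    using invariant_subspace[OF assms(1)] assms(2) by blast
  then show ?thesis
    using assms(3) by auto
qed

text \<open>A nontrivial relation would put \<open>M *v (M *v e)\<close> into the span of
  \<open>e\<close> and \<open>M *v e\<close>, or \<open>M *v e\<close> into the span of
  \<open>e\<close>. Either span would be a proper invariant subspace containing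
  \<open>e\<close>.\<close>

lemma quad_eq_0:
  assumes "quad (a, b, c) = 0"
  shows "a = 0 \<and> b = 0 \<and> c = 0"
proof -
  obtain e :: "'a ^ 3" where "e \<noteq> 0"
    by (metis axis_eq_0_iff zero_neq_one)
  have rel: "a *s e + b *s (M *v e) + c *s (M *v (M *v e)) = 0"
    using assms quad_vector[of a b c e] by simp
  have "c = 0"
  proof (rule ccontr)
    assume "c \<noteq> 0"
    let ?f = "\<lambda>(s, t). s *s e + t *s (M *v e)"
    have "c *s (M *v (M *v e)) = - (a *s e) - b *s (M *v e)"
      using rel by (simp add: algebra_simps eq_neg_iff_add_eq_0)
    then have "inverse c *s (c *s (M *v (M *v e))) = inverse c *s (- (a *s e) - b *s (M *v e))"
      by simp
    then have M2: "M *v (M *v e) = (inverse c * a) *s e + (inverse c * b) *s (M *v e)"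
      using \<open>c \<noteq> 0\<close> by (simp add: vec_eq_iff algebra_simps)
    have "e = 0"
    proof (rule no_small_invariant[of ?f])
      show "vec.subspace (range ?f)"
        unfolding vec.subspace_def
      proof (intro conjI ballI allI)
        show "0 \<in> range ?f"
          by (auto intro!: image_eqI[of _ _ "(0, 0)"])
        fix x y assume "x \<in> range ?f" "y \<in> range ?f"
        then obtain s t s' t' where "x = ?f (s, t)" "y = ?f (s', t')"
          by auto
        then show "x + y \<in> range ?f"
          by (intro image_eqI[of _ _ "(s + s', t + t')"]) (auto simp: vector_sadd_rdistrib)
      next
        fix k x assume "x \<in> range ?f"
        then obtain s t where "x = ?f (s, t)"
          by auto
        then show "k *s x \<in> range ?f"
          by (intro image_eqI[of _ _ "(k * s, k * t)"]) (auto simp: vector_add_ldistrib)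
      qed
      show "M *v ?f p \<in> range ?f" for p
      proof -
        obtain s t where p: "p = (s, t)"
          by (cases p)
        have "M *v ?f p = s *s (M *v e) + t *s (M *v (M *v e))"
          by (simp add: p matrix_vector_right_distrib vector_scalar_commute)
        also have "\<dots> = ?f (t * (inverse c * a), s + t * (inverse c * b))"
          unfolding M2 by (simp add: vec_eq_iff algebra_simps)
        finally show ?thesis
          by blast
      qed
      show "e \<in> range ?f"
        by (auto intro!: image_eqI[of _ _ "(1, 0)"])
    qed
    then show False
      using \<open>e \<noteq> 0\<close> by simp
  qed
  moreover have "b = 0"
  proof (rule ccontr)
    assume "b \<noteq> 0"
    \<comment> \<open>The line through \<open>e\<close>, parametrised redundantly by pairs to fit
      \<open>no_small_invariant\<close>.\<close>
    let ?f = "\<lambda>(s, t). (s + t) *s e"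
    have "b *s (M *v e) = a *s e"
      using rel \<open>c = 0\<close> by (simp add: vec_eq_iff)
    then have "inverse b *s (b *s (M *v e)) = inverse b *s (a *s e)"
      by simp
    then have M1: "M *v e = (inverse b * a) *s e"
      using \<open>b \<noteq> 0\<close> by simp
    have "e = 0"
    proof (rule no_small_invariant[of ?f])
      have f: "range ?f = range (\<lambda>s. s *s e)"
        by (auto intro!: image_eqI[of _ _ "(_, 0)"])
      show "vec.subspace (range ?f)"
        unfolding vec.subspace_def f
        by (auto simp: vector_sadd_rdistrib[symmetric] intro: range_eqI[of _ _ 0])
      show "M *v ?f p \<in> range ?f" for p
        unfolding f by (auto simp: vector_scalar_commute M1 split: prod.split)
      show "e \<in> range ?f"
        unfolding f by (auto intro: range_eqI[of _ _ 1])
    qed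
    then show False
      using \<open>e \<noteq> 0\<close> by simp
  qed
  ultimately show ?thesis
    using rel \<open>e \<noteq> 0\<close> by simp
qed

lemma quad_add: "quad (a, b, c) + quad (a', b', c') = quad (a + a', b + b', c + c')"
  by (simp add: quad_def mat_add matrix_add_rdistrib algebra_simps)

lemma matrix_add_self: "Y + Y = (0 :: 'a ^ 3 ^ 3)"
  by (simp add: vec_eq_iff)

lemma inj_quad: "inj quad"
proof (rule injI)
  fix x y assume "quad x = quad y"
  moreover obtain a b c a' b' c' where xy: "x = (a, b, c)" "y = (a', b', c')"
    by (cases x, cases y) auto
  ultimately have "quad (a + a', b + b', c + c') = 0"
    by (metis quad_add matrix_add_self)
  then show "x = y"
    using quad_eq_0 by (force simp: xy)
qed

lemma card_triples: "card (UNIV :: ('a \<times> 'a \<times> 'a) set) = q ^ 6"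
  unfolding UNIV_Times_UNIV[symmetric] card_cartesian_product card_field
  by (simp flip: power_add)

lemma cent_eq_range_quad: "cent = range quad"
  and card_cent: "card cent = q ^ 6"
proof -
  obtain e :: "'a ^ 3" where "e \<noteq> 0"
    by (metis axis_eq_0_iff zero_neq_one)
  \<comment> \<open>evaluation at \<open>e\<close> bounds \<open>card cent\<close> from above, the polynomials in \<open>M\<close> from below\<close>
  have "inj_on (\<lambda>Y. Y *v e) cent"
  proof (rule inj_onI)
    fix Y Z assume "Y \<in> cent" "Z \<in> cent" "Y *v e = Z *v e"
    then have "(Y + Z) *v e = 0"
      by (simp add: matrix_vector_mult_add_rdistrib) (simp add: vec_eq_iff)
    then have "Y + Z = 0"
      using cent_kernel \<open>e \<noteq> 0\<close> \<open>Y \<in> cent\<close> \<open>Z \<in> cent\<close> cent_closed by blast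
    then show "Y = Z"
      by (simp add: vec_eq_iff)
  qed
  then have "card cent \<le> card (UNIV :: ('a ^ 3) set)"
    by (intro card_inj_on_le) auto
  moreover have "card (range quad) = q ^ 6"
    using inj_quad by (simp only: card_image card_triples)
  moreover have sub: "range quad \<subseteq> cent"
    using quad_in_cent by auto
  moreover from sub have "card (range quad) \<le> card cent"
    by (intro card_mono) auto
  ultimately show "card cent = q ^ 6"
    by (simp only: card_vec3)
  then show "cent = range quad"
    using sub \<open>card (range quad) = q ^ 6\<close> by (intro card_subset_eq[symmetric]) auto
qed

text \<open>\<open>Z\<close> is a polynomial in \<open>M\<close> with scalar coefficients, and
  \<open>Y\<close> commutes with \<open>M\<close> and with scalars.\<close>

lemma cent_commute:
  assumes "Y \<in> cent" "Z \<in> cent"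
  shows "Y ** Z = Z ** Y"
proof -
  obtain a b c where Z: "Z = quad (a, b, c)"
    using assms(2) by (auto simp: cent_eq_range_quad)
  have M: "Y ** M = M ** Y"
    using assms(1) by (simp add: cent_def)
  have "Y ** (mat b ** M) = (mat b ** M) ** Y"
    using M by (intro matrix_commute_mult mat_mult_commute[symmetric])
  moreover have "Y ** (mat c ** (M ** M)) = (mat c ** (M ** M)) ** Y"
    using M by (intro matrix_commute_mult mat_mult_commute[symmetric])
  ultimately show ?thesis
    by (simp add: Z quad_def matrix_add_ldistrib matrix_add_rdistrib mat_mult_commute)
qed

section \<open>The unit group of the centraliser and the Frobenius powers\<close>

definition unit_group :: "('a ^ 3 ^ 3) monoid" where
  "unit_group = \<lparr>carrier = cent - {0}, mult = (**), one = mat 1\<rparr>"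

lemma comm_group_unit_group: "comm_group unit_group"
proof (rule comm_groupI)
  fix Y Z assume YZ: "Y \<in> carrier unit_group" "Z \<in> carrier unit_group"
  have "Y ** Z \<noteq> 0"
  proof
    assume "Y ** Z = 0"
    obtain Y' where "Y' ** Y = mat 1"
      using cent_inverse YZ by (auto simp: unit_group_def)
    then have "Z = Y' ** (Y ** Z)"
      by (metis matrix_mul_assoc matrix_mul_lid)
    then show False
      using \<open>Y ** Z = 0\<close> YZ by (simp add: unit_group_def)
  qed
  then show "Y \<otimes>\<^bsub>unit_group\<^esub> Z \<in> carrier unit_group"
    using YZ by (simp add: unit_group_def cent_closed)
next
  fix Y Z assume "Y \<in> carrier unit_group" "Z \<in> carrier unit_group"
  then show "Y \<otimes>\<^bsub>unit_group\<^esub> Z = Z \<otimes>\<^bsub>unit_group\<^esub> Y"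
    by (simp add: unit_group_def cent_commute)
next
  fix Y assume "Y \<in> carrier unit_group"
  then show "\<exists>Z\<in>carrier unit_group. Z \<otimes>\<^bsub>unit_group\<^esub> Y = \<one>\<^bsub>unit_group\<^esub>"
    using cent_inverse[of Y] by (auto simp: unit_group_def)
qed (simp_all add: unit_group_def matrix_mul_assoc mat_in_cent)

lemma card_unit_group: "order unit_group = q ^ 6 - 1"
proof -
  have "(0 :: 'a ^ 3 ^ 3) \<in> cent"
    by (simp add: cent_def)
  then show ?thesis
    by (simp add: order_def unit_group_def card_Diff_singleton card_cent)
qed

text \<open>Iterated squaring expresses \<open>2^k\<close>-th powers on all of \<open>cent\<close>,
  including 0, without reference to a group; \<open>sqr_pow_eq_pow\<close> then links it to powers
  in both \<open>SU\<close> and \<open>unit_group\<close>.\<close>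

abbreviation sqr :: "'a ^ 3 ^ 3 \<Rightarrow> 'a ^ 3 ^ 3" where
  "sqr \<equiv> \<lambda>Y. Y ** Y"

lemma sqr_pow_in_cent: "Y \<in> cent \<Longrightarrow> (sqr ^^ k) Y \<in> cent"
  by (induction k) (auto intro: cent_closed)

text \<open>In the square of a sum the two mixed terms are equal by commutativity and cancel in
  characteristic 2.\<close>

lemma sqr_pow_add: "Y \<in> cent \<Longrightarrow> Z \<in> cent \<Longrightarrow> (sqr ^^ k) (Y + Z) = (sqr ^^ k) Y + (sqr ^^ k) Z"
proof (induction k)
  case (Suc k)
  let ?Y = "(sqr ^^ k) Y" and ?Z = "(sqr ^^ k) Z"
  have "?Y ** ?Z = ?Z ** ?Y"
    using Suc.prems by (intro cent_commute sqr_pow_in_cent)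
  then have "(?Y + ?Z) ** (?Y + ?Z) = ?Y ** ?Y + ?Z ** ?Z + (?Y ** ?Z + ?Y ** ?Z)"
    by (simp add: matrix_add_ldistrib matrix_add_rdistrib algebra_simps)
  then show ?case
    using Suc by (simp add: matrix_add_self)
qed simp

lemma sqr_pow_mult: "Y \<in> cent \<Longrightarrow> Z \<in> cent \<Longrightarrow> (sqr ^^ k) (Y ** Z) = (sqr ^^ k) Y ** (sqr ^^ k) Z"
proof (induction k)
  case (Suc k)
  let ?Y = "(sqr ^^ k) Y" and ?Z = "(sqr ^^ k) Z"
  have "?Y ** ?Z = ?Z ** ?Y"
    using Suc.prems by (intro cent_commute sqr_pow_in_cent)
  have "(?Y ** ?Z) ** (?Y ** ?Z) = ?Y ** (?Z ** ?Y) ** ?Z"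
    by (simp only: matrix_mul_assoc)
  also have "\<dots> = (?Y ** ?Y) ** (?Z ** ?Z)"
    by (simp only: \<open>?Y ** ?Z = ?Z ** ?Y\<close>[symmetric] matrix_mul_assoc)
  finally have "(?Y ** ?Z) ** (?Y ** ?Z) = (?Y ** ?Y) ** (?Z ** ?Z)" .
  then show ?case
    using Suc by simp
qed simp

lemma sqr_pow_mat: "(sqr ^^ k) (mat a) = mat (a ^ (2 ^ k))"
  by (induction k) (simp_all add: mat_mult_mat power_add[symmetric] mult_2)

lemma sqr_pow_eq_pow:
  fixes G :: "('a ^ 3 ^ 3) monoid"
  assumes "group G" "\<And>A B. A \<otimes>\<^bsub>G\<^esub> B = A ** B" "Y \<in> carrier G"
  shows "(sqr ^^ k) Y = Y [^]\<^bsub>G\<^esub> (2 ^ k :: nat)"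
proof -
  interpret group G by fact
  show ?thesis
  proof (induction k)
    case 0
    then show ?case
      using assms(3) nat_pow_eone by simp
  next
    case (Suc k)
    then show ?case
      using nat_pow_mult[OF assms(3), of "2 ^ k" "2 ^ k"] by (simp add: assms(2) mult_2)
  qed
qed

lemma q_cubed: "q ^ 3 = 2 ^ (n * 3)"
  by (simp only: power_mult q_eq[symmetric])

text \<open>Since \<open>r\<close> divides \<open>q^3 + 1\<close>, the power of \<open>M\<close>
  with exponent \<open>q^3\<close> is the inverse of \<open>M\<close>, which is
  \<open>star M\<close>.\<close>

lemma sqr_pow_M: "(sqr ^^ (n * 3)) M = star M"
proof -
  have "r dvd q ^ 3 + 1"
    using r(2) singer_factor[of q] by (metis dvd_mult2)
  then obtain k where k: "q ^ 3 + 1 = r * k"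
    by (auto elim: dvdE)
  have "M [^]\<^bsub>SU\<^esub> (q ^ 3 + 1) = mat 1"
    unfolding k using M SU.nat_pow_one[of k] by (simp add: SU.nat_pow_pow[symmetric])
  then have "(M [^]\<^bsub>SU\<^esub> (q ^ 3)) ** M = mat 1"
    by simp
  moreover have "star M ** M = mat 1" "M ** star M = mat 1"
    using M(1) by (simp_all add: mem_SU matrix_left_right_inverse)
  ultimately have "M [^]\<^bsub>SU\<^esub> (q ^ 3) = star M"
    by (metis matrix_mul_assoc matrix_mul_lid matrix_mul_rid)
  then show ?thesis
    using sqr_pow_eq_pow[OF group_SU _ M(1), of "n * 3"] by (simp add: q_cubed)
qed

lemma star_mat: "star (mat a) = mat (a ^ q)"
  using q_ge_2 by (simp add: conj_transpose_def mat_def vec_eq_iff)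

lemma star_add: "star (A + B) = star A + star B"
  by (simp add: conj_transpose_def vec_eq_iff frob_add)

lemma star_eq_sqr_pow:
  assumes "Y \<in> cent"
  shows "star Y = (sqr ^^ (n * 3)) Y"
proof -
  obtain a b c where Y: "Y = quad (a, b, c)"
    using assms by (auto simp: cent_eq_range_quad)
  have scalar: "a ^ (2 ^ (n * 3)) = a ^ q" for a :: 'a
  proof -
    have "a ^ (q ^ 3) = ((a ^ q) ^ q) ^ q"
      by (simp only: power_mult[symmetric] power3_eq_cube)
    then show ?thesis
      by (simp add: q_cubed[symmetric])
  qed
  show ?thesis
    unfolding Y quad_def
    by (simp add: sqr_pow_add sqr_pow_mult cent_closed mat_in_cent M_in_cent sqr_pow_mat sqr_pow_M
        star_add star_mult star_mat scalar mat_mult_commute)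
qed

lemma ex_singer_subgroup:
  "\<exists>K. subgroup K SU \<and> card K = q\<^sup>2 - q + 1 \<and> (\<forall>A\<in>K. \<forall>B\<in>K. A ** B = B ** A)"
proof -
  interpret E: comm_group unit_group
    by (rule comm_group_unit_group)
  let ?m = "q\<^sup>2 - q + 1"
  \<comment> \<open>\<open>q^2 - q + 1\<close> divides \<open>q^3 + 1\<close> and therefore the
    order of the cyclic-type group \<open>unit_group\<close>, which is abelian.\<close>
  have "q ^ 6 - 1 = (q ^ 3 + 1) * (q ^ 3 - 1)"
    by (simp add: algebra_simps flip: power_add)
  then have "?m dvd order unit_group"
    by (metis card_unit_group dvd_mult2 dvd_triv_left singer_factor)
  then obtain K where K: "subgroup K unit_group" "card K = ?m"
    using E.ex_mls_subgroup_of_order by auto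
  have mult [simp]: "A \<otimes>\<^bsub>unit_group\<^esub> B = A ** B" "\<one>\<^bsub>unit_group\<^esub> = mat 1" for A B
    by (simp_all add: unit_group_def)
  have in_cent: "Y \<in> cent" if "Y \<in> K" for Y
    using that subgroup.subset[OF K(1)] by (auto simp: unit_group_def)
  have K_SU: "Y \<in> carrier SU" if "Y \<in> K" for Y
  proof -
    have Y: "Y \<in> carrier unit_group"
      using that K(1) by (rule subgroup.mem_carrier[rotated])
    have pow: "Y [^]\<^bsub>unit_group\<^esub> ?m = mat 1"
      using E.subgroup_card_pow_eq_one[OF K(1) _ that] K(2) by simp
    have "star Y = Y [^]\<^bsub>unit_group\<^esub> (q ^ 3)"
      using star_eq_sqr_pow[OF in_cent[OF that]] sqr_pow_eq_pow[OF E.is_group _ Y] by (simp add: q_cubed)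
    then have "star Y ** Y = Y [^]\<^bsub>unit_group\<^esub> (q ^ 3 + 1)"
      by simp
    also have "\<dots> = mat 1"
      unfolding singer_factor[symmetric] E.nat_pow_pow[OF Y, symmetric] pow
      using E.nat_pow_one[of "q + 1"] by simp
    finally have unitary: "star Y ** Y = mat 1" .
    \<comment> \<open>Determinant 1 needs its own argument: the order of \<open>det Y\<close>
      divides both \<open>q^2 - q + 1\<close> and \<open>q^2 - 1\<close>, which are coprime.\<close>
    have "det (Y [^]\<^bsub>unit_group\<^esub> k) = det Y ^ k" for k :: nat
      by (induction k) (simp_all add: det_mul mult.commute)
    then have "det Y ^ ?m = 1"
      using pow by (metis det_I)
    moreover have "det Y \<noteq> 0"
      using unitary by (metis det_I det_mul mult_zero_right zero_neq_one)
    then have "det Y ^ (q\<^sup>2 - 1) = 1"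
      by (rule pow_card_minus_1)
    moreover have "coprime ?m (q\<^sup>2 - 1)"
      using coprime_singer[OF coprime3 q_pos] by simp
    ultimately have "det Y = 1"
      by (rule power_coprime_eq_one) simp
    then show ?thesis
      using unitary by (simp add: mem_SU)
  qed
  have "subgroup K SU"
  proof (rule SU.subgroupI)
    show "K \<noteq> {}"
      using K(1) subgroup.one_closed by blast
    show "inv\<^bsub>SU\<^esub> Y \<in> K" if "Y \<in> K" for Y
    proof -
      have "inv\<^bsub>unit_group\<^esub> Y \<in> K"
        using K(1) that by (rule subgroup.m_inv_closed)
      moreover have "inv\<^bsub>unit_group\<^esub> Y ** Y = mat 1"
        using E.l_inv[of Y] that K(1) subgroup.mem_carrier by fastforce
      ultimately show ?thesis
        using SU.inv_equality[of "inv\<^bsub>unit_group\<^esub> Y" Y] K_SU that by simp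
    qed
    show "Y \<otimes>\<^bsub>SU\<^esub> Z \<in> K" if "Y \<in> K" "Z \<in> K" for Y Z
      using subgroup.m_closed[OF K(1)] that by simp
  qed (use K_SU in auto)
  then show ?thesis
    using K(2) in_cent cent_commute by blast
qed

end

section \<open>The Singer-type subgroup inside \<open>SU\<close> and the two cases\<close>

context hyperbolic_pair
begin

text \<open>Supplies the element required by \<open>singer_element\<close>: Sylow's theorem with
  exponent 1 gives a subgroup of prime order \<open>r\<close>, and any nontrivial member serves as
  \<open>M\<close>.\<close>

lemma ex_singer_subgroup_SU:
  assumes "coprime 3 (q + 1)"
  shows "\<exists>K. subgroup K SU \<and> card K = q\<^sup>2 - q + 1 \<and> (\<forall>A\<in>K. \<forall>B\<in>K. A ** B = B ** A)"
proof -
  have "q\<^sup>2 - q + 1 \<noteq> 1"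
    using q_ge_2 by (simp add: power2_eq_square)
  then obtain r where r: "prime r" "r dvd q\<^sup>2 - q + 1"
    using prime_factor_nat by blast
  have "r dvd q ^ 3 + 1"
    using r(2) singer_factor[of q] by (metis dvd_mult2)
  then have "r dvd order SU"
    unfolding order_SU by (intro dvd_mult2)
  then obtain k where "order SU = r ^ 1 * k"
    by (auto elim: dvdE)
  then obtain R where R: "subgroup R SU" "card R = r"
    using sylow_thm[OF r(1) group_SU _ finite_SU] by (metis power_one_right)
  have "\<not> R \<subseteq> {mat 1}"
    using R(2) r(1) card_mono[of "{mat 1}" R] prime_gt_1_nat[of r] by auto
  then obtain M where "M \<in> R" "M \<noteq> mat 1"
    by auto
  moreover have "M [^]\<^bsub>SU\<^esub> r = mat 1"
    using SU.subgroup_card_pow_eq_one[OF R(1) _ \<open>M \<in> R\<close>] R(2) by simp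
  ultimately interpret singer_element n q field_type M r
    using assms r subgroup.mem_carrier[OF R(1)] by unfold_locales auto
  show ?thesis
    by (rule ex_singer_subgroup)
qed

text \<open>The conjugate of \<open>h\<close> has order dividing both \<open>card K\<close> and
  \<open>card borel\<close>.\<close>

lemma coprime_order_conj_borel:
  assumes "subgroup K SU" "coprime (card K) (card borel)"
    and "g \<in> carrier SU" "h \<in> K" "inv\<^bsub>SU\<^esub> g \<otimes>\<^bsub>SU\<^esub> h \<otimes>\<^bsub>SU\<^esub> g \<in> borel"
  shows "h = \<one>\<^bsub>SU\<^esub>"
proof -
  \<comment> \<open>Keeps products in group notation, so that the simplification rules for groups
    still apply.\<close>
  note [simp del] = SU_mult SU_one
  have h: "h \<in> carrier SU"
    using assms(1,4) by (rule subgroup.mem_carrier)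
  let ?k = "inv\<^bsub>SU\<^esub> g \<otimes>\<^bsub>SU\<^esub> h \<otimes>\<^bsub>SU\<^esub> g"
  have k: "?k \<in> carrier SU"
    using h assms(3) by simp
  have cancel: "g \<otimes>\<^bsub>SU\<^esub> (inv\<^bsub>SU\<^esub> g \<otimes>\<^bsub>SU\<^esub> x) = x" if "x \<in> carrier SU" for x
    using that assms(3) by (simp flip: SU.m_assoc)
  have "?k [^]\<^bsub>SU\<^esub> i = inv\<^bsub>SU\<^esub> g \<otimes>\<^bsub>SU\<^esub> h [^]\<^bsub>SU\<^esub> i \<otimes>\<^bsub>SU\<^esub> g" for i :: nat
  proof (induction i)
    case 0
    then show ?case
      using assms(3) by simp
  next
    case (Suc i)
    then show ?case
      using cancel h assms(3) by (simp add: SU.m_assoc)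
  qed
  then have "?k [^]\<^bsub>SU\<^esub> card K = \<one>\<^bsub>SU\<^esub>"
    using SU.subgroup_card_pow_eq_one[OF assms(1) _ assms(4)] assms(3) by simp
  moreover have "?k [^]\<^bsub>SU\<^esub> card borel = \<one>\<^bsub>SU\<^esub>"
    using SU.subgroup_card_pow_eq_one[OF subgroup_borel _ assms(5)] by simp
  ultimately have "?k = \<one>\<^bsub>SU\<^esub>"
    using SU.pow_coprime_eq_one[OF k] assms(2) by blast
  moreover have "h = g \<otimes>\<^bsub>SU\<^esub> ?k \<otimes>\<^bsub>SU\<^esub> inv\<^bsub>SU\<^esub> g"
    using cancel h assms(3) by (simp add: SU.m_assoc)
  ultimately show ?thesis
    using assms(3) by simp
qed

lemma mls_set_SU:
  assumes "coprime 3 (q + 1)" "prime (q + 1) \<or> prime (q\<^sup>2 - q + 1)"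
  shows "mls_set SU (carrier SU)"
  using assms(2)
proof
  assume "prime (q + 1)"
  obtain K where K: "subgroup K SU" "card K = q\<^sup>2 - q + 1" "\<forall>A\<in>K. \<forall>B\<in>K. A ** B = B ** A"
    using ex_singer_subgroup_SU[OF assms(1)] by blast
  show ?thesis
  proof (rule mls_set_SU_by_double_cosets[OF K(1) _ \<open>prime (q + 1)\<close>])
    show "mls_set SU K"
      using K(3) by (intro SU.mls_set_commutative_subgroup K(1)) auto
    show "card K * (q + 1) = q ^ 3 + 1"
      unfolding K(2) by (rule singer_factor)
    have "coprime (card K) (card borel)"
      unfolding K(2) card_borel using assms(1) q_ge_2 by (intro coprime_singer) auto
    then show "h = \<one>\<^bsub>SU\<^esub>" if "g \<in> carrier SU" "h \<in> K" "inv\<^bsub>SU\<^esub> g \<otimes>\<^bsub>SU\<^esub> h \<otimes>\<^bsub>SU\<^esub> g \<in> borel"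
      for g h
      using coprime_order_conj_borel K(1) that by blast
  qed
next
  assume "prime (q\<^sup>2 - q + 1)"
  then show ?thesis
  proof (rule mls_set_SU_by_double_cosets[OF subgroup_diag mls_set_diag_subgroup])
    show "card diag_subgroup * (q\<^sup>2 - q + 1) = q ^ 3 + 1"
      unfolding card_diag_subgroup by (metis mult.commute singer_factor)
  qed (rule diag_subgroup_conj_borel)
qed

end

theorem theorem4p2:
  fixes n :: nat and q :: nat
  assumes "q = 2 ^ n" and "n > 1"
    and "CARD('a::{field, finite}) = q ^ 2"
    and "prime (q + 1) \<or> prime (q ^ 2 - q + 1)"
  shows "has_MLS (PSU3 q :: ('a^3^3) set monoid)"
proof -
  interpret even_hermitian_field n q "TYPE('a)"
    using assms by unfold_locales auto
  obtain u v where "hyperbolic u v"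
    using ex_hyperbolic by blast
  then interpret hyperbolic_pair n q "TYPE('a)" u v
    by unfold_locales
  \<comment> \<open>Here \<open>n > 1\<close> enters: for \<open>q = 2\<close> both
    \<open>q + 1\<close> and \<open>q^2 - q + 1\<close> equal the prime 3.\<close>
  have "q \<ge> 2 ^ 2"
    unfolding assms(1) using assms(2) by (intro power_increasing) auto
  have "\<not> 3 dvd q + 1"
  proof
    assume 3: "3 dvd q + 1"
    \<comment> \<open>Writing \<open>q = 3 j + 2\<close> shows that both candidates are multiples of
      3; both exceed 3, so neither is prime.\<close>
    have "3 dvd q ^ 2 - q + 1"
    proof -
      obtain k where "q + 1 = 3 * k"
        using 3 by (auto elim: dvdE)
      moreover from this \<open>q \<ge> 2 ^ 2\<close> obtain j where "k = Suc j"
        by (cases k) auto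
      ultimately have "q = 3 * j + 2"
        by simp
      then have "q ^ 2 - q + 1 = 3 * (3 * j * j + 3 * j + 1)"
        by (simp add: power2_eq_square algebra_simps)
      then show ?thesis
        by (metis dvd_triv_left)
    qed
    moreover have "q ^ 2 - q + 1 > 3" "q + 1 > 3"
    proof -
      obtain j where "q = 4 + j"
        using \<open>q \<ge> 2 ^ 2\<close> le_Suc_ex by auto
      then show "q ^ 2 - q + 1 > 3" "q + 1 > 3"
        by (simp_all add: power2_eq_square algebra_simps)
    qed
    ultimately show False
      using 3 assms(4) primes_dvd_imp_eq[of 3 "q + 1"] primes_dvd_imp_eq[of 3 "q ^ 2 - q + 1"] by auto
  qed
  then have "coprime 3 (q + 1)"
    by (intro prime_imp_coprime) auto
  then show ?thesis
    using has_MLS_PSU3 mls_set_SU assms(4) by blast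
qed

end
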